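(* Assume that the mesh $\mathcal{T}_h$ is globally quasi-uniform with the global mesh size $h$, and let $\varrho=h^4$. Let $S_h=\varrho K_hD_h^{-1}K_h+M_h$ with $D_h=\mathrm{lump}(M_h)$. Then the spectral equivalence inequalities $$\underline{c}_{SD}\,D_h\le\underline{c}_{SM}\,M_h\le S_h\le\overline{c}_{SM}\,M_h\le\overline{c}_{SD}\,D_h$$ hold with the constants $$\underline{c}_{SM}=1,\qquad \overline{c}_{SM}=c_{\mathrm{inv}}^4\,\overline{c}_{MD}+1,\qquad \underline{c}_{SD}=\underline{c}_{MD}=\lambda_{\min}(D_\tau^{-1}M_\tau)=\frac{1}{d+2},$$ $$\overline{c}_{SD}=\overline{c}_{MD}^2\,c_{\mathrm{inv}}^4+\overline{c}_{MD},\qquad\text{where } \overline{c}_{MD}=\lambda_{\max}(D_\tau^{-1}M_\tau)=1.$$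
   Context: For symmetric matrices, $A\le B$ means $(A\mathbf{v},\mathbf{v})\le(B\mathbf{v},\mathbf{v})$ for all vectors $\mathbf{v}$. $\Omega\subset\mathbb{R}^d$, $d\in\{1,2,3\}$, is a bounded Lipschitz domain (an interval for $d=1$, polygonally bounded for $d=2$, polyhedrally bounded for $d=3$). $\mathcal{T}_h=\{\tau_e\}$ is an admissible (conforming), shape-regular, globally quasi-uniform decomposition of $\Omega$ into simplices with global mesh size $h$. $\{\varphi_j^h\}_{j=1}^{\overline n_h}$ are the continuous piecewise linear nodal (hat) basis functions on $\mathcal{T}_h$, where indices $j\le n_h$ correspond to interior vertices and $j>n_h$ to vertices on $\partial\Omega$; $V_h=\mathrm{span}\{\varphi_j^h\}_{j=1}^{n_h}\subset H_0^1(\Omega)$. For $i,j=1,\dots,n_h$: $M_h[i,j]=\int_\Omega\varphi_j^h\varphi_i^h\,dx$ (mass matrix), $K_h[i,j]=\int_\Omega\nabla\varphi_j^h\cdot\nabla\varphi_i^h\,dx$ (stiffness matrix), and $\mathrm{lump}(M_h)[i,j]=\delta_{i,j}\sum_{k=1}^{\overline n_h}\int_\Omega\varphi_k^h\varphi_i^h\,dx$ (diagonal lumped mass matrix). $M_\tau$ and $D_\tau$ are the $(d+1)\times(d+1)$ mass matrix and lumped (row-sum diagonal) mass matrix of the linear nodal basis functions on the reference element $\tau$ (the unit simplex), and $\lambda_{\min},\lambda_{\max}$ denote the extremal eigenvalues of the generalized eigenvalue problem $M_\tau\mathbf{v}=\lambda D_\tau\mathbf{v}$. The constant $c_{\mathrm{inv}}>0$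 is a constant, uniform in the mesh, of the local inverse inequalities $\|\nabla w_h\|_{L_2(\tau_e)}\le c_{\mathrm{inv}}\,h^{-1}\|w_h\|_{L_2(\tau_e)}$ for all $w_h\in V_h$ and all $\tau_e\in\mathcal{T}_h$. *)

theory Defs
  imports "HOL-Analysis.Analysis" "Jordan_Normal_Form.Gauss_Jordan_Elimination"
begin

text \<open>
  Geometry lives in the type \<open>real^'d\<close>. Finite element matrices, whose size depends on the mesh,
  are matrices of the type \<open>real mat\<close> with indices starting at 0. Both libraries use the same
  infix symbols for components and inner products, so \<open>inner\<close> and \<open>scalar_prod\<close> are written out.
\<close>

section \<open>Domains and meshes\<close>

text \<open>
  Near each boundary point the domain is the strict epigraph, in some direction \<open>\<nu>\<close>, of a Lipschitz
  function on the hyperplane orthogonal to \<open>\<nu>\<close>. For \<open>d = 1\<close> that hyperplane is \<open>{0}\<close>, and such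
  domains are exactly the bounded open intervals.
\<close>

definition bounded_lipschitz_domain :: "(real^'d) set \<Rightarrow> bool" where
  "bounded_lipschitz_domain \<Omega> \<longleftrightarrow>
     \<Omega> \<noteq> {} \<and> open \<Omega> \<and> connected \<Omega> \<and> bounded \<Omega> \<and>
     (\<forall>x\<in>frontier \<Omega>. \<exists>\<nu> g L U. norm \<nu> = 1 \<and> L-lipschitz_on {y. inner y \<nu> = 0} g \<and> open U \<and> x \<in> U \<and>
        (\<forall>y\<in>U. y \<in> \<Omega> \<longleftrightarrow> g (y - inner y \<nu> *\<^sub>R \<nu>) < inner y \<nu>))"

definition polyhedrally_bounded :: "(real^'d) set \<Rightarrow> bool" where
  "polyhedrally_bounded \<Omega> \<longleftrightarrow>
     (\<exists>\<F>. finite \<F> \<and> (\<forall>F\<in>\<F>. polytope F \<and> aff_dim F = int CARD('d) - 1) \<and> frontier \<Omega> = \<Union>\<F>)"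

definition admissible_mesh :: "(real^'d) set \<Rightarrow> (real^'d) set set \<Rightarrow> bool" where
  "admissible_mesh \<Omega> \<T> \<longleftrightarrow>
     triangulation \<T> \<and> (\<forall>\<tau>\<in>\<T>. int CARD('d) simplex \<tau>) \<and> \<Union>\<T> = closure \<Omega>"

text \<open>
  Shape regularity and quasi-uniformity are properties of a family of meshes: the constants must not
  depend on the member of the family.
\<close>

definition shape_regular :: "('i \<Rightarrow> (real^'d) set set) \<Rightarrow> bool" where
  "shape_regular \<T> \<longleftrightarrow> (\<exists>\<sigma>>0. \<forall>i. \<forall>\<tau>\<in>\<T> i. \<exists>x. cball x (\<sigma> * diameter \<tau>) \<subseteq> \<tau>)"

text \<open>
  The global mesh size \<open>h\<close> is determined only up to uniform factors. This covers the usual choices,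
  such as the maximal element diameter and, for shape-regular families, the maximum of \<open>|\<tau>|\<^bsup>1/d\<^esup>\<close>.
\<close>

definition globally_quasi_uniform :: "('i \<Rightarrow> (real^'d) set set) \<Rightarrow> ('i \<Rightarrow> real) \<Rightarrow> bool" where
  "globally_quasi_uniform \<T> h \<longleftrightarrow>
     (\<exists>c C. 0 < c \<and> 0 < C \<and>
        (\<forall>i. 0 < h i \<and> (\<forall>\<tau>\<in>\<T> i. c * h i \<le> diameter \<tau> \<and> diameter \<tau> \<le> C * h i)))"

definition mesh_vertices :: "(real^'d) set set \<Rightarrow> (real^'d) set" where
  "mesh_vertices \<T> = {q. \<exists>\<tau>\<in>\<T>. q extreme_point_of \<tau>}"

definition node_numbering ::
    "(real^'d) set \<Rightarrow> (real^'d) set set \<Rightarrow> (nat \<Rightarrow> real^'d) \<Rightarrow> nat \<Rightarrow> nat \<Rightarrow> bool" where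
  "node_numbering \<Omega> \<T> p n nbar \<longleftrightarrow>
     bij_betw p {..<nbar} (mesh_vertices \<T>) \<and> n \<le> nbar \<and>
     (\<forall>j<n. p j \<in> \<Omega>) \<and> (\<forall>j\<in>{n..<nbar}. p j \<in> frontier \<Omega>)"


section \<open>Continuous piecewise linear functions\<close>

text \<open>Functions on the meshed region are extended by zero, which makes the hat function unique.\<close>

definition p1_functions :: "(real^'d) set set \<Rightarrow> (real^'d \<Rightarrow> real) set" where
  "p1_functions \<T> =
     {w. continuous_on (\<Union>\<T>) w \<and> (\<forall>\<tau>\<in>\<T>. \<exists>a b. \<forall>x\<in>\<tau>. w x = inner a x + b) \<and>
         (\<forall>x. x \<notin> \<Union>\<T> \<longrightarrow> w x = 0)}"

definition hat :: "(real^'d) set set \<Rightarrow> real^'d \<Rightarrow> real^'d \<Rightarrow> real" where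
  "hat \<T> q = (THE w. w \<in> p1_functions \<T> \<and> (\<forall>r\<in>mesh_vertices \<T>. w r = (if r = q then 1 else 0)))"

definition fe_space :: "nat \<Rightarrow> (nat \<Rightarrow> real^'d \<Rightarrow> real) \<Rightarrow> (real^'d \<Rightarrow> real) set" where
  "fe_space n \<phi> = {w. \<exists>c. w = (\<lambda>x. \<Sum>j<n. c j * \<phi> j x)}"

text \<open>
  For piecewise linear functions this is the elementwise, hence weak, gradient off the null set of
  element boundaries; its unspecified values on that set do not affect any integral below.
\<close>

definition gradient :: "(real^'d \<Rightarrow> real) \<Rightarrow> real^'d \<Rightarrow> real^'d" where
  "gradient f x = (THE D. GDERIV f x :> D)"

definition L2_norm_on :: "(real^'d) set \<Rightarrow> (real^'d \<Rightarrow> 'b::real_normed_vector) \<Rightarrow> real" where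
  "L2_norm_on S f = sqrt (LINT x:S|lebesgue. (norm (f x))\<^sup>2)"


section \<open>Finite element matrices\<close>

definition mass_mat :: "(real^'d) set \<Rightarrow> nat \<Rightarrow> (nat \<Rightarrow> real^'d \<Rightarrow> real) \<Rightarrow> real mat" where
  "mass_mat S n \<phi> = mat n n (\<lambda>(i, j). LINT x:S|lebesgue. \<phi> j x * \<phi> i x)"

definition stiffness_mat :: "(real^'d) set \<Rightarrow> nat \<Rightarrow> (nat \<Rightarrow> real^'d \<Rightarrow> real) \<Rightarrow> real mat" where
  "stiffness_mat S n \<phi> =
     mat n n (\<lambda>(i, j). LINT x:S|lebesgue. inner (gradient (\<phi> j) x) (gradient (\<phi> i) x))"

text \<open>The row sums run over all \<open>nbar\<close> basis functions, including those of boundary nodes.\<close>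

definition lumped_mass_mat ::
    "(real^'d) set \<Rightarrow> nat \<Rightarrow> nat \<Rightarrow> (nat \<Rightarrow> real^'d \<Rightarrow> real) \<Rightarrow> real mat" where
  "lumped_mass_mat S n nbar \<phi> =
     mat n n (\<lambda>(i, j). if i = j then \<Sum>k<nbar. LINT x:S|lebesgue. \<phi> k x * \<phi> i x else 0)"

definition mat_inv :: "real mat \<Rightarrow> real mat" where
  "mat_inv A = the (mat_inverse A)"

definition schur_mat :: "real \<Rightarrow> real mat \<Rightarrow> real mat \<Rightarrow> real mat \<Rightarrow> real mat" where
  "schur_mat \<rho> K D M = \<rho> \<cdot>\<^sub>m (K * mat_inv D * K) + M"

text \<open>The order is only meant for symmetric matrices of equal size, so this is part of the relation.\<close>

definition mat_le :: "real mat \<Rightarrow> real mat \<Rightarrow> bool" (infix "\<preceq>\<^sub>m" 50) where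
  "A \<preceq>\<^sub>m B \<longleftrightarrow>
     (\<exists>n. A \<in> carrier_mat n n \<and> B \<in> carrier_mat n n \<and>
        transpose_mat A = A \<and> transpose_mat B = B \<and>
        (\<forall>v\<in>carrier_vec n. scalar_prod (A *\<^sub>v v) v \<le> scalar_prod (B *\<^sub>v v) v))"

definition generalized_eigenvalues :: "real mat \<Rightarrow> real mat \<Rightarrow> real set" where
  "generalized_eigenvalues A B =
     {\<mu>. \<exists>v\<in>carrier_vec (dim_col A). v \<noteq> 0\<^sub>v (dim_col A) \<and> A *\<^sub>v v = \<mu> \<cdot>\<^sub>v (B *\<^sub>v v)}"


section \<open>The reference element\<close>

definition unit_simplex :: "(real^'d) set" where
  "unit_simplex = convex hull (insert 0 Basis)"

text \<open>Vertex 0 is the origin; the others are the unit vectors, in a fixed numbering of the axes.\<close>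

definition ref_vertex :: "nat \<Rightarrow> real^'d" where
  "ref_vertex k = (if k = 0 then 0 else axis (from_nat_into UNIV (k - 1)) 1)"

definition ref_basis :: "nat \<Rightarrow> real^'d \<Rightarrow> real" where
  "ref_basis k = hat {unit_simplex} (ref_vertex k)"

definition ref_mass_mat :: "'d::finite itself \<Rightarrow> real mat" where
  "ref_mass_mat _ = mass_mat (unit_simplex :: (real^'d) set) (CARD('d) + 1) ref_basis"

definition ref_lumped_mass_mat :: "'d::finite itself \<Rightarrow> real mat" where
  "ref_lumped_mass_mat _ =
     lumped_mass_mat (unit_simplex :: (real^'d) set) (CARD('d) + 1) (CARD('d) + 1) ref_basis"

definition lambda_min_ref :: "'d::finite itself \<Rightarrow> real" where
  "lambda_min_ref d = Min (generalized_eigenvalues (ref_mass_mat d) (ref_lumped_mass_mat d))"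

definition lambda_max_ref :: "'d::finite itself \<Rightarrow> real" where
  "lambda_max_ref d = Max (generalized_eigenvalues (ref_mass_mat d) (ref_lumped_mass_mat d))"

end

(*
  Each of the three quadratic forms is a sum over the elements. On an element, barycentric
  coordinates satisfy  int l_q l_r = |tau| (1 + delta_qr) / ((d+1)(d+2))  and
  int l_q = |tau| / (d+1), so an affine w with nodal values w_q has
  int w^2 = |tau| (sum w_q^2 + (sum w_q)^2) / ((d+1)(d+2)),  while the lumped form is
  |tau| (sum w_q^2) / (d+1). This gives D / (d+2) <= M <= D, and on the reference element the
  eigenvalues of I + 1 1^T yield 1/(d+2) and 1. Summing the squared inverse inequalities gives
  K <= k M with k = (c_inv / h)^2. For w = D^-1 K v, Cauchy-Schwarz in the K-form yields
  (Dw,w)^2 = (Kv,w)^2 <= (Kv,v)(Kw,w) <= k^2 (Mv,v)(Mw,w) <= k^2 (Mv,v)(Dw,w),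
  so that K D^-1 K <= k^2 M, and h^4 k^2 = c_inv^4.
*)

theory Submission
  imports Defs
begin

section \<open>Integrals of affine functions over simplices\<close>

text \<open>The lumped form is treated as an integral too: for coefficients \<open>v_j\<close> it
  equals the integral of the piecewise linear function with nodal values \<open>v_j^2\<close>.
  Comparing it with the mass form becomes a question about one affine function on one simplex.
  Boundary nodes enter in two ways. Their hats complete the partition of unity, which collapses the
  row sums to integrals of single hats; and they carry coefficient 0, so that the element estimate
  over all \<open>d + 1\<close> vertices applies unchanged next to the boundary. Two null sets have
  to be controlled. The elements tile the closure of the domain while the matrices integrate over
  the open domain, and the polyhedral boundary makes the difference negligible. Gradients are
  determined only in the interior of elements, so the stiffness form is expanded through the
  constant gradients there. The element integrals use only homotheties about a vertex, under which
  the other barycentric coordinates are homogeneous.\<close>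

definition affine_on :: "'a::euclidean_space set \<Rightarrow> ('a \<Rightarrow> real) \<Rightarrow> bool" where
  "affine_on S f \<longleftrightarrow> (\<exists>a b. \<forall>x\<in>S. f x = inner a x + b)"

lemma affine_on_const: "affine_on S (\<lambda>x. c)"
  unfolding affine_on_def by (rule exI[of _ 0]) auto

lemma affine_on_add:
  assumes "affine_on S f" "affine_on S g"
  shows "affine_on S (\<lambda>x. f x + g x)"
proof -
  obtain a b a' b' where "\<forall>x\<in>S. f x = inner a x + b" "\<forall>x\<in>S. g x = inner a' x + b'"
    using assms unfolding affine_on_def by blast
  then have "\<forall>x\<in>S. f x + g x = inner (a + a') x + (b + b')"
    by (simp add: inner_left_distrib)
  then show ?thesis unfolding affine_on_def by blast
qed

lemma affine_on_cmult:
  assumes "affine_on S f"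
  shows "affine_on S (\<lambda>x. c * f x)"
proof -
  obtain a b where "\<forall>x\<in>S. f x = inner a x + b"
    using assms unfolding affine_on_def by blast
  then have "\<forall>x\<in>S. c * f x = inner (c *\<^sub>R a) x + c * b"
    by (simp add: algebra_simps)
  then show ?thesis unfolding affine_on_def by blast
qed

lemma affine_on_sum:
  assumes "\<And>i. i \<in> I \<Longrightarrow> affine_on S (f i)"
  shows "affine_on S (\<lambda>x. \<Sum>i\<in>I. f i x)"
  using assms
proof (induction I rule: infinite_finite_induct)
  case (insert i I)
  then show ?case using affine_on_add[of S "f i"] by simp
qed (simp_all add: affine_on_const)

lemma affine_on_subset: "affine_on T f \<Longrightarrow> S \<subseteq> T \<Longrightarrow> affine_on S f"
  unfolding affine_on_def by blast

text \<open>The condition \<open>sum u C = 1\<close> reproduces the constant \<open>b\<close>.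
  Negative weights occur later, for points outside the simplex.\<close>

lemma affine_on_combination:
  assumes "affine_on S f" "finite C" "C \<subseteq> S" "sum u C = 1" "(\<Sum>q\<in>C. u q *\<^sub>R q) \<in> S"
  shows "f (\<Sum>q\<in>C. u q *\<^sub>R q) = (\<Sum>q\<in>C. u q * f q)"
proof -
  obtain a b where ab: "\<forall>x\<in>S. f x = inner a x + b"
    using assms unfolding affine_on_def by blast
  have "f (\<Sum>q\<in>C. u q *\<^sub>R q) = (\<Sum>q\<in>C. u q * inner a q) + b * sum u C"
    using ab assms by (simp add: inner_sum_right)
  also have "\<dots> = (\<Sum>q\<in>C. u q * (inner a q + b))"
    by (simp only: distrib_left sum.distrib sum_distrib_right[symmetric] mult.commute[of b])
  also have "\<dots> = (\<Sum>q\<in>C. u q * f q)"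
    using ab assms(3) by (intro sum.cong) auto
  finally show ?thesis .
qed

lemma affine_on_eq_on_convex_hull:
  assumes "finite C" "affine_on (convex hull C) f" "affine_on (convex hull C) g"
    and "\<And>q. q \<in> C \<Longrightarrow> f q = g q" and "x \<in> convex hull C"
  shows "f x = g x"
proof -
  obtain u where u: "sum u C = 1" "(\<Sum>q\<in>C. u q *\<^sub>R q) = x"
    using assms(5) unfolding convex_hull_finite[OF assms(1)] by blast
  have sub: "C \<subseteq> convex hull C" by (rule hull_subset)
  have "f x = (\<Sum>q\<in>C. u q * f q)"
    using affine_on_combination[OF assms(2,1) sub u(1)] assms(5) unfolding u(2) by blast
  moreover have "g x = (\<Sum>q\<in>C. u q * g q)"
    using affine_on_combination[OF assms(3,1) sub u(1)] assms(5) unfolding u(2) by blast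
  ultimately show ?thesis using assms(4) by simp
qed

lemma continuous_on_affine_on: "affine_on S f \<Longrightarrow> continuous_on S f"
proof -
  assume "affine_on S f"
  then obtain a b where ab: "\<And>x. x \<in> S \<Longrightarrow> f x = inner a x + b"
    unfolding affine_on_def by blast
  have "continuous_on S (\<lambda>x. inner a x + b)" by (intro continuous_intros)
  then show ?thesis by (rule continuous_on_eq) (simp add: ab)
qed

text \<open>Translating one point \<open>a\<close> of \<open>C\<close> to the origin turns affine
  into linear independence, and values prescribed on an independent set extend to a linear
  functional.\<close>

lemma affine_interpolation:
  fixes C :: "'a::euclidean_space set"
  assumes "\<not> affine_dependent C"
  obtains g where "affine_on UNIV g" "\<And>q. q \<in> C \<Longrightarrow> g q = f q"
proof (cases "C = {}")
  case True
  then show ?thesis using that[OF affine_on_const] by simp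
next
  case False
  then obtain a where a: "a \<in> C" by blast
  have "independent ((\<lambda>x. - a + x) ` (C - {a}))"
    using assms affine_dependent_iff_dependent2[OF a] by blast
  from linear_independent_extend[OF this, of "\<lambda>y. f (a + y) - f a :: real"]
  obtain l where l: "linear l" "\<forall>y\<in>(\<lambda>x. - a + x) ` (C - {a}). l y = f (a + y) - f a"
    by blast
  \<comment> \<open>The Riesz representative of \<open>l\<close>, since \<open>affine_on\<close>
    asks for an inner product.\<close>
  define c where "c = adjoint l (1::real)"
  have c: "l y = inner c y" for y
    using adjoint_works[OF l(1), of y 1] unfolding c_def by (simp add: inner_commute)
  define g where "g = (\<lambda>x. inner c x + (f a - inner c a))"
  have "g q = f q" if "q \<in> C" for q
  proof (cases "q = a")
    case False
    then have "l (- a + q) = f (a + (- a + q)) - f a" using l(2) that by blast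
    then show ?thesis unfolding g_def c by (simp add: inner_diff_right inner_add_right)
  qed (simp add: g_def)
  moreover have "affine_on UNIV g"
    unfolding affine_on_def g_def by blast
  ultimately show ?thesis using that[of g] by blast
qed

lemma set_integrable_lebesgue_compact:
  fixes f :: "'a::euclidean_space \<Rightarrow> real"
  assumes "compact S" "continuous_on S f"
  shows "set_integrable lebesgue S f"
proof -
  have "integrable lborel (\<lambda>x. indicator S x *\<^sub>R f x)"
    by (rule borel_integrable_compact[OF assms])
  then show ?thesis
    unfolding set_integrable_def using integrable_completion[of _ lborel] by blast
qed

text \<open>Bridge from nonnegative integrals over \<open>lborel\<close>, where scaling and Fubini
  are carried out, to the Bochner integrals over \<open>lebesgue\<close> in the matrices. For a
  Borel integrand, completing the measure does not change the integral.\<close>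

lemma set_lebesgue_integral_eqI_nn_integral:
  fixes f :: "'a::euclidean_space \<Rightarrow> real"
  assumes "compact S" "continuous_on S f" "\<And>x. x \<in> S \<Longrightarrow> 0 \<le> f x" "0 \<le> c"
    and "(\<integral>\<^sup>+x. indicator S x * ennreal (f x) \<partial>lborel) = ennreal c"
  shows "(LINT x:S|lebesgue. f x) = c"
proof -
  have "integrable lborel (\<lambda>x. indicator S x *\<^sub>R f x)"
    by (rule borel_integrable_compact[OF assms(1,2)])
  then have m: "(\<lambda>x. indicator S x *\<^sub>R f x) \<in> borel_measurable lborel" by blast
  have "(LINT x:S|lebesgue. f x) = integral\<^sup>L lborel (\<lambda>x. indicator S x *\<^sub>R f x)"
    unfolding set_lebesgue_integral_def by (rule integral_completion[OF m])
  also have "\<dots> = enn2real (\<integral>\<^sup>+x. ennreal (indicator S x *\<^sub>R f x) \<partial>lborel)"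
    by (rule integral_eq_nn_integral[OF m]) (use assms(3) in \<open>auto split: split_indicator\<close>)
  also have "(\<integral>\<^sup>+x. ennreal (indicator S x *\<^sub>R f x) \<partial>lborel) = (\<integral>\<^sup>+x. indicator S x * ennreal (f x) \<partial>lborel)"
    by (intro nn_integral_cong) (auto split: split_indicator)
  finally show ?thesis using assms(4,5) by simp
qed

lemma set_lebesgue_integral_sum:
  fixes f :: "'i \<Rightarrow> 'a \<Rightarrow> 'b::{banach, second_countable_topology}"
  assumes "\<And>i. i \<in> I \<Longrightarrow> set_integrable M S (f i)"
  shows "(LINT x:S|M. \<Sum>i\<in>I. f i x) = (\<Sum>i\<in>I. LINT x:S|M. f i x)"
  using assms unfolding set_lebesgue_integral_def set_integrable_def scaleR_sum_right
  by (rule Bochner_Integration.integral_sum)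

section \<open>Barycentric coordinates of a full-dimensional simplex\<close>

locale full_simplex =
  fixes C :: "'a::euclidean_space set"
  assumes indep: "\<not> affine_dependent C"
    and card_vertices: "card C = DIM('a) + 1"
begin

text \<open>Affine on the whole space rather than on the simplex, so that homothetic images and
  points outside the simplex can be inserted; \<open>affine_interpolation\<close> supplies a
  function to choose.\<close>

definition bary :: "'a \<Rightarrow> 'a \<Rightarrow> real" where
  "bary q = (SOME l. affine_on UNIV l \<and> (\<forall>r\<in>C. l r = of_bool (r = q)))"

lemma bary_props: "affine_on UNIV (bary q) \<and> (\<forall>r\<in>C. bary q r = of_bool (r = q))"
proof -
  obtain g where "affine_on UNIV g" "\<And>r. r \<in> C \<Longrightarrow> g r = (of_bool (r = q) :: real)"
    using affine_interpolation[OF indep, of "\<lambda>r. of_bool (r = q)"] by blast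
  then have "\<exists>l. affine_on UNIV l \<and> (\<forall>r\<in>C. l r = of_bool (r = q))" by blast
  then show ?thesis unfolding bary_def by (rule someI_ex)
qed

lemma affine_bary: "affine_on UNIV (bary q)"
  using bary_props by blast

lemma bary_vertex: "r \<in> C \<Longrightarrow> bary q r = of_bool (r = q)"
  using bary_props by blast

lemma continuous_bary: "continuous_on S (bary q)"
  using affine_bary affine_on_subset continuous_on_affine_on by blast

lemma borel_measurable_bary [measurable]: "bary q \<in> borel_measurable borel"
  by (rule borel_measurable_continuous_onI) (rule continuous_bary)

lemma finite_vertices: "finite C"
  by (rule card_ge_0_finite) (simp add: card_vertices)

lemma bary_combination:
  assumes "sum u C = 1" "q \<in> C"
  shows "bary q (\<Sum>r\<in>C. u r *\<^sub>R r) = u q"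
proof -
  have "bary q (\<Sum>r\<in>C. u r *\<^sub>R r) = (\<Sum>r\<in>C. u r * bary q r)"
    by (rule affine_on_combination[OF affine_bary finite_vertices _ assms(1)]) auto
  also have "\<dots> = (\<Sum>r\<in>C. if r = q then u r else 0)"
    using bary_vertex by (intro sum.cong) auto
  also have "\<dots> = u q" using assms(2) finite_vertices by simp
  finally show ?thesis .
qed

text \<open>Valid at every point: \<open>DIM('a) + 1\<close> affinely independent points have the
  whole space as affine hull, so \<open>x\<close> is an affine combination of the vertices, and
  \<open>bary\<close> recovers its weights.\<close>

lemma sum_bary: "(\<Sum>q\<in>C. bary q x) = 1"
  and sum_bary_scaleR: "(\<Sum>q\<in>C. bary q x *\<^sub>R q) = x"
proof -
  have "affine hull C = UNIV"
    using affine_independent_span_eq[OF indep] card_vertices by simp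
  then have "x \<in> affine hull C" by simp
  then obtain u where u: "sum u C = 1" "(\<Sum>v\<in>C. u v *\<^sub>R v) = x"
    unfolding affine_hull_finite[OF finite_vertices] by blast
  then have "bary q x = u q" if "q \<in> C" for q
    using bary_combination[OF u(1) that] by simp
  then show "(\<Sum>q\<in>C. bary q x) = 1" "(\<Sum>q\<in>C. bary q x *\<^sub>R q) = x"
    using u by simp_all
qed

lemma affine_on_eq_sum_bary:
  assumes "affine_on (convex hull C) g" "x \<in> convex hull C"
  shows "g x = (\<Sum>q\<in>C. g q * bary q x)"
proof -
  have "g (\<Sum>q\<in>C. bary q x *\<^sub>R q) = (\<Sum>q\<in>C. bary q x * g q)"
    by (rule affine_on_combination[OF assms(1) finite_vertices hull_subset sum_bary])
      (use assms(2) sum_bary_scaleR in simp)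
  then show ?thesis by (simp add: sum_bary_scaleR mult.commute)
qed

lemma mem_hull_iff: "x \<in> convex hull C \<longleftrightarrow> (\<forall>q\<in>C. 0 \<le> bary q x)"
proof
  assume "x \<in> convex hull C"
  then obtain u where u: "\<forall>v\<in>C. 0 \<le> u v" "sum u C = 1" "(\<Sum>v\<in>C. u v *\<^sub>R v) = x"
    unfolding convex_hull_finite[OF finite_vertices] by blast
  then show "\<forall>q\<in>C. 0 \<le> bary q x" using bary_combination[OF u(2)] by auto
next
  assume "\<forall>q\<in>C. 0 \<le> bary q x"
  then show "x \<in> convex hull C"
    unfolding convex_hull_finite[OF finite_vertices]
    using sum_bary[of x] sum_bary_scaleR[of x] by (intro CollectI exI[of _ "\<lambda>q. bary q x"]) simp
qed

lemma bary_le_1: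
  assumes "q \<in> C" "x \<in> convex hull C"
  shows "bary q x \<le> 1"
proof -
  have "bary q x \<le> (\<Sum>r\<in>C. bary r x)"
    using assms mem_hull_iff finite_vertices by (intro member_le_sum) auto
  then show ?thesis using sum_bary by simp
qed

text \<open>The coordinates of the other vertices vanish at the centre \<open>q\<close> and are
  therefore multiplied by \<open>c\<close>; for \<open>r = q\<close> it is \<open>1 - bary q\<close>
  that is multiplied by \<open>c\<close>.\<close>

lemma bary_homothety:
  assumes "q \<in> C"
  shows "bary r (q + c *\<^sub>R (x - q)) = c * bary r x + (1 - c) * of_bool (q = r)"
proof -
  obtain a b where ab: "\<And>y. bary r y = inner a y + b"
    using affine_bary unfolding affine_on_def by blast
  have "bary r (q + c *\<^sub>R (x - q)) = c * bary r x + (1 - c) * bary r q"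
    unfolding ab by (simp add: algebra_simps)
  then show ?thesis using bary_vertex[OF assms] by simp
qed

text \<open>Read in coordinates: for \<open>r \<noteq> q\<close> the sign of \<open>bary r\<close>
  is preserved, and the threshold \<open>1 - c\<close> for \<open>bary q\<close> at the image is the
  threshold 0 at \<open>x\<close>.\<close>

lemma homothety_mem_iff:
  assumes "q \<in> C" "0 < c" "c \<le> 1"
  shows "q + c *\<^sub>R (x - q) \<in> convex hull C \<and> 1 - c \<le> bary q (q + c *\<^sub>R (x - q)) \<longleftrightarrow> x \<in> convex hull C"
    (is "?y \<in> _ \<and> _ \<longleftrightarrow> _")
proof -
  have *: "0 \<le> bary r ?y \<longleftrightarrow> 0 \<le> bary r x" if "r \<noteq> q" for r
    using that assms by (simp add: bary_homothety zero_le_mult_iff)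
  have **: "1 - c \<le> bary q ?y \<longleftrightarrow> 0 \<le> bary q x"
    using assms by (simp add: bary_homothety zero_le_mult_iff)
  show ?thesis
  proof
    assume L: "?y \<in> convex hull C \<and> 1 - c \<le> bary q ?y"
    have "0 \<le> bary r x" if "r \<in> C" for r
      using L * ** that by (cases "r = q") (auto simp: mem_hull_iff)
    then show "x \<in> convex hull C" unfolding mem_hull_iff by blast
  next
    assume R: "x \<in> convex hull C"
    then have q: "1 - c \<le> bary q ?y" using ** assms(1) by (simp add: mem_hull_iff)
    have "0 \<le> bary r ?y" if "r \<in> C" for r
    proof (cases "r = q")
      case True
      have "0 \<le> bary q ?y" using q assms(3) by linarith
      then show ?thesis unfolding True .
    next
      case False
      then show ?thesis using R * that by (simp add: mem_hull_iff)
    qed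
    then show "?y \<in> convex hull C \<and> 1 - c \<le> bary q ?y"
      unfolding mem_hull_iff using q by blast
  qed
qed

text \<open>
  The superlevel set of a barycentric coordinate is the image of the simplex under a homothety with
  centre \<open>q\<close>; together with the layer-cake formula this gives all the element integrals without a
  change of variables for general linear maps (which the library has only for well-ordered index types).
\<close>

lemma nn_integral_superlevel:
  assumes q: "q \<in> C" and f[measurable]: "f \<in> borel_measurable borel"
    and hom: "\<And>c x. 0 < c \<Longrightarrow> f (q + c *\<^sub>R (x - q)) = c ^ m * f x"
    and s: "0 \<le> s" "s < 1"
  shows "(\<integral>\<^sup>+x. indicator {x. x \<in> convex hull C \<and> s \<le> bary q x} x * ennreal (f x) \<partial>lborel)
       = ennreal ((1 - s) ^ (DIM('a) + m)) * (\<integral>\<^sup>+x. indicator (convex hull C) x * ennreal (f x) \<partial>lborel)"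
proof -
  define c where "c = 1 - s"
  have c: "0 < c" "c \<le> 1" "s = 1 - c" using s by (auto simp: c_def)
  \<comment> \<open>Puts the homothety into the form expected by
    \<open>lborel_affine\<close>.\<close>
  define t where "t = q - c *\<^sub>R q"
  have t: "t + c *\<^sub>R x = q + c *\<^sub>R (x - q)" for x by (simp add: t_def algebra_simps)
  have hull[measurable]: "convex hull C \<in> sets borel"
    using finite_vertices by (intro borel_closed compact_imp_closed compact_convex_hull finite_imp_compact)
  have "(\<integral>\<^sup>+x. indicator {x. x \<in> convex hull C \<and> s \<le> bary q x} x * ennreal (f x) \<partial>lborel)
      = (\<integral>\<^sup>+x. indicator {x. x \<in> convex hull C \<and> s \<le> bary q x} x * ennreal (f x)
             \<partial>density (distr lborel borel (\<lambda>x. t + c *\<^sub>R x)) (\<lambda>_. ennreal (\<bar>c\<bar> ^ DIM('a))))"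
    using lborel_affine[of c t] c by simp
  also have "\<dots> = (\<integral>\<^sup>+x. ennreal (\<bar>c\<bar> ^ DIM('a)) *
      (indicator {x. x \<in> convex hull C \<and> s \<le> bary q x} (t + c *\<^sub>R x) * ennreal (f (t + c *\<^sub>R x))) \<partial>lborel)"
    by (simp add: nn_integral_density nn_integral_distr)
  \<comment> \<open>The factor \<open>c ^ DIM('a)\<close> is the Jacobian of the homothety;
    \<open>c ^ m\<close> is the homogeneity of \<open>f\<close> about \<open>q\<close>.\<close>
  also have "\<dots> = (\<integral>\<^sup>+x. ennreal (c ^ (DIM('a) + m)) * (indicator (convex hull C) x * ennreal (f x)) \<partial>lborel)"
  proof (rule nn_integral_cong)
    fix x
    have "indicator {x. x \<in> convex hull C \<and> s \<le> bary q x} (t + c *\<^sub>R x) = (indicator (convex hull C) x :: ennreal)"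
      using homothety_mem_iff[OF q c(1,2), of x] unfolding t c(3) by (auto split: split_indicator)
    moreover have "ennreal (f (t + c *\<^sub>R x)) = ennreal (c ^ m) * ennreal (f x)"
      using hom[OF c(1)] c(1) unfolding t by (simp add: ennreal_mult')
    ultimately show "ennreal (\<bar>c\<bar> ^ DIM('a)) *
      (indicator {x. x \<in> convex hull C \<and> s \<le> bary q x} (t + c *\<^sub>R x) * ennreal (f (t + c *\<^sub>R x)))
      = ennreal (c ^ (DIM('a) + m)) * (indicator (convex hull C) x * ennreal (f x))"
      using c(1) by (simp add: power_add ennreal_mult ac_simps)
  qed
  also have "\<dots> = ennreal (c ^ (DIM('a) + m)) * (\<integral>\<^sup>+x. indicator (convex hull C) x * ennreal (f x) \<partial>lborel)"
    by (rule nn_integral_cmult) measurable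
  finally show ?thesis by (simp add: c_def)
qed

text \<open>Layer cake: \<open>bary q x\<close> is the length of the set of levels
  \<open>s \<le> bary q x\<close>. After exchanging the integrals, the superlevel formula leaves the
  integral of \<open>(1 - s) ^ (DIM('a) + m)\<close> over the unit interval, which is the constant.
  The function 1 has \<open>m = 0\<close>, and \<open>bary r\<close> with
  \<open>r \<noteq> q\<close> has \<open>m = 1\<close>.\<close>

lemma nn_integral_times_bary:
  assumes q: "q \<in> C" and f[measurable]: "f \<in> borel_measurable borel"
    and hom: "\<And>c x. 0 < c \<Longrightarrow> f (q + c *\<^sub>R (x - q)) = c ^ m * f x"
  shows "(\<integral>\<^sup>+x. indicator (convex hull C) x * ennreal (f x * bary q x) \<partial>lborel)
       = ennreal (1 / (DIM('a) + m + 1)) * (\<integral>\<^sup>+x. indicator (convex hull C) x * ennreal (f x) \<partial>lborel)"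
    (is "?L = _ * ?I")
proof -
  have hull[measurable]: "convex hull C \<in> sets borel"
    using finite_vertices by (intro borel_closed compact_imp_closed compact_convex_hull finite_imp_compact)
  \<comment> \<open>The level \<open>s = 1\<close> is left out because
    \<open>nn_integral_superlevel\<close> requires a positive homothety ratio; a single level has
    measure zero.\<close>
  have layer: "(\<integral>\<^sup>+s. indicator {s. 0 \<le> s \<and> s < 1 \<and> s \<le> bary q x} s \<partial>lborel) = ennreal (bary q x)"
    if "x \<in> convex hull C" for x
  proof -
    have b: "0 \<le> bary q x" "bary q x \<le> 1" using that q mem_hull_iff bary_le_1 by auto
    show ?thesis
    proof (cases "bary q x = 1")
      case True
      then have "{s. 0 \<le> s \<and> s < 1 \<and> s \<le> bary q x} = {0..<1}" by auto
      then show ?thesis using True by simp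
    next
      case False
      then have "{s. 0 \<le> s \<and> s < 1 \<and> s \<le> bary q x} = {0..bary q x}" using b by auto
      then show ?thesis using b by simp
    qed
  qed
  have "?L = (\<integral>\<^sup>+x. \<integral>\<^sup>+s. indicator (convex hull C) x * ennreal (f x) *
      indicator {s. 0 \<le> s \<and> s < 1 \<and> s \<le> bary q x} s \<partial>lborel \<partial>lborel)"
  proof (rule nn_integral_cong)
    fix x
    have "(\<integral>\<^sup>+s. indicator (convex hull C) x * ennreal (f x) *
      indicator {s. 0 \<le> s \<and> s < 1 \<and> s \<le> bary q x} s \<partial>lborel) = indicator (convex hull C) x * ennreal (f x) *
      (\<integral>\<^sup>+s. indicator {s. 0 \<le> s \<and> s < 1 \<and> s \<le> bary q x} s \<partial>lborel)"
      by (rule nn_integral_cmult) measurable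
    also have "\<dots> = indicator (convex hull C) x * ennreal (f x * bary q x)"
    proof (cases "x \<in> convex hull C")
      case True
      then have "0 \<le> bary q x" using q mem_hull_iff by auto
      then show ?thesis using layer[OF True] True by (simp add: ennreal_mult'')
    qed simp
    finally show "indicator (convex hull C) x * ennreal (f x * bary q x) = (\<integral>\<^sup>+s. indicator (convex hull C) x * ennreal (f x) *
      indicator {s. 0 \<le> s \<and> s < 1 \<and> s \<le> bary q x} s \<partial>lborel)" by simp
  qed
  also have "\<dots> = (\<integral>\<^sup>+s. \<integral>\<^sup>+x. indicator (convex hull C) x * ennreal (f x) *
      indicator {s. 0 \<le> s \<and> s < 1 \<and> s \<le> bary q x} s \<partial>lborel \<partial>lborel)"
  proof -
    have "(\<lambda>(x, s). indicator (convex hull C) x * ennreal (f x) *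
      indicator {s. 0 \<le> s \<and> s < 1 \<and> s \<le> bary q x} s) \<in> borel_measurable (lborel \<Otimes>\<^sub>M lborel)"
      by (simp add: indicator_def split_beta') measurable
    then show ?thesis by (rule lborel_pair.Fubini'[symmetric])
  qed
  also have "\<dots> = (\<integral>\<^sup>+s. ennreal ((1 - s) ^ (DIM('a) + m)) * indicator {0..1} s * ?I \<partial>lborel)"
  proof (rule nn_integral_cong)
    fix s :: real
    show "(\<integral>\<^sup>+x. indicator (convex hull C) x * ennreal (f x) *
      indicator {s. 0 \<le> s \<and> s < 1 \<and> s \<le> bary q x} s \<partial>lborel) = ennreal ((1 - s) ^ (DIM('a) + m)) * indicator {0..1} s * ?I"
    proof (cases "0 \<le> s \<and> s < 1")
      case True
      have "(\<integral>\<^sup>+x. indicator (convex hull C) x * ennreal (f x) *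
         indicator {s. 0 \<le> s \<and> s < 1 \<and> s \<le> bary q x} s \<partial>lborel)
        = (\<integral>\<^sup>+x. indicator {x. x \<in> convex hull C \<and> s \<le> bary q x} x * ennreal (f x) \<partial>lborel)"
        using True by (intro nn_integral_cong) (auto split: split_indicator)
      then show ?thesis using nn_integral_superlevel[OF q f hom] True by simp
    next
      case False
      then have "indicator {s. 0 \<le> s \<and> s < 1 \<and> s \<le> bary q x} s = (0::ennreal)" for x by auto
      \<comment> \<open>At \<open>s = 1\<close> the indicator of \<open>{0..1}\<close> is still 1,
        but the power vanishes because its exponent is positive.\<close>
      moreover have "ennreal ((1 - s) ^ (DIM('a) + m)) * indicator {0..1} s = 0"
        using False by (cases "s = 1") (auto split: split_indicator)
      ultimately show ?thesis by simp
    qed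
  qed
  also have "\<dots> = (\<integral>\<^sup>+s. ennreal ((1 - s) ^ (DIM('a) + m)) * indicator {0..1} s \<partial>lborel) * ?I"
    by (rule nn_integral_multc) measurable
  also have "(\<integral>\<^sup>+s. ennreal ((1 - s) ^ (DIM('a) + m)) * indicator {0..1} s \<partial>lborel) = ennreal (1 / (DIM('a) + m + 1))"
  proof -
    define k where "k = DIM('a) + m"
    have "(\<integral>\<^sup>+s. ennreal ((1 - s) ^ k) * indicator {0..1} s \<partial>lborel)
        = ennreal (- ((1 - 1) ^ (k + 1) / (real k + 1)) - - ((1 - 0) ^ (k + 1) / (real k + 1)))"
    proof (rule nn_integral_FTC_Icc[where F = "\<lambda>s. - ((1 - s) ^ (k + 1) / (real k + 1))"])
      fix s :: real assume "s \<in> {0..1}"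
      then have "s \<le> 1" by simp
      show "((\<lambda>s. - ((1 - s) ^ (k + 1) / (real k + 1))) has_real_derivative (1 - s) ^ k) (at s)"
        by (rule derivative_eq_intros refl | simp)+ (auto simp: field_simps)
      show "0 \<le> (1 - s) ^ k" using \<open>s \<le> 1\<close> by simp
    qed auto
    then show ?thesis by (simp add: k_def add.commute)
  qed
  finally show ?thesis .
qed

section \<open>Integrals of affine functions and of their products\<close>

abbreviation volume :: real where
  "volume \<equiv> measure lborel (convex hull C)"

lemma compact_hull: "compact (convex hull C)"
  using finite_vertices by (intro compact_convex_hull finite_imp_compact)

lemma hull_sets: "convex hull C \<in> sets lebesgue"
  using lmeasurable_compact[OF compact_hull] by blast

lemma emeasure_hull: "emeasure lborel (convex hull C) = ennreal volume"
  using emeasure_bounded_finite[OF compact_imp_bounded[OF compact_hull]]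
  by (intro emeasure_eq_ennreal_measure) auto

lemma set_integrable_hull:
  assumes "continuous_on (convex hull C) f"
  shows "set_integrable lebesgue (convex hull C) (f :: 'a \<Rightarrow> real)"
  by (rule set_integrable_lebesgue_compact[OF compact_hull assms])

lemma nn_integral_bary:
  assumes "q \<in> C"
  shows "(\<integral>\<^sup>+x. indicator (convex hull C) x * ennreal (bary q x) \<partial>lborel) = ennreal (volume / (real DIM('a) + 1))"
proof -
  have "convex hull C \<in> sets borel"
    using compact_hull by (simp add: borel_compact)
  then have "(\<integral>\<^sup>+x. indicator (convex hull C) x * ennreal (bary q x) \<partial>lborel)
      = ennreal (1 / (real DIM('a) + 1)) * emeasure lborel (convex hull C)"
    using nn_integral_times_bary[OF assms, of "\<lambda>_. 1" 0] by (simp add: add.commute)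
  also have "\<dots> = ennreal (1 / (real DIM('a) + 1) * volume)"
    unfolding emeasure_hull by (rule ennreal_mult[symmetric]) auto
  finally show ?thesis by (simp add: mult.commute)
qed

lemma integral_bary:
  assumes "q \<in> C"
  shows "(LINT x:convex hull C|lebesgue. bary q x) = volume / (real DIM('a) + 1)"
  by (rule set_lebesgue_integral_eqI_nn_integral[OF compact_hull continuous_bary _ _ nn_integral_bary[OF assms]])
    (use assms mem_hull_iff in auto)

text \<open>The layer-cake formula is used with centre \<open>r\<close> and
  \<open>f = bary q\<close>. As \<open>q \<noteq> r\<close>, this \<open>f\<close> vanishes at
  \<open>r\<close> and is homogeneous of degree 1 about it, which gives the factor
  \<open>1 / (d + 2)\<close> on top of the integral of \<open>bary q\<close>.\<close>

lemma integral_bary_mult: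
  assumes "q \<in> C" "r \<in> C" "q \<noteq> r"
  shows "(LINT x:convex hull C|lebesgue. bary q x * bary r x) = volume / ((real DIM('a) + 1) * (real DIM('a) + 2))"
proof (rule set_lebesgue_integral_eqI_nn_integral[OF compact_hull])
  show "continuous_on (convex hull C) (\<lambda>x. bary q x * bary r x)"
    by (intro continuous_intros continuous_bary)
  show "0 \<le> bary q x * bary r x" if "x \<in> convex hull C" for x
    using that assms mem_hull_iff by auto
  show "0 \<le> volume / ((real DIM('a) + 1) * (real DIM('a) + 2))" by simp
  have "(\<integral>\<^sup>+x. indicator (convex hull C) x * ennreal (bary q x * bary r x) \<partial>lborel)
      = ennreal (1 / (real DIM('a) + 1 + 1)) * (\<integral>\<^sup>+x. indicator (convex hull C) x * ennreal (bary q x) \<partial>lborel)"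
  proof -
    have "bary q (r + c *\<^sub>R (x - r)) = c ^ 1 * bary q x" if "0 < c" for c x
      using bary_homothety[OF assms(2)] assms(3) by simp
    from nn_integral_times_bary[OF assms(2) borel_measurable_bary this]
    show ?thesis by (simp add: add_ac)
  qed
  also have "\<dots> = ennreal (1 / (real DIM('a) + 1 + 1) * (volume / (real DIM('a) + 1)))"
    unfolding nn_integral_bary[OF assms(1)] by (rule ennreal_mult[symmetric]) auto
  also have "1 / (real DIM('a) + 1 + 1) * (volume / (real DIM('a) + 1)) = volume / ((real DIM('a) + 1) * (real DIM('a) + 2))"
    by (simp add: field_simps)
  finally show "(\<integral>\<^sup>+x. indicator (convex hull C) x * ennreal (bary q x * bary r x) \<partial>lborel)
      = ennreal (volume / ((real DIM('a) + 1) * (real DIM('a) + 2)))" .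
qed

text \<open>\<open>bary q\<close> is not homogeneous about \<open>q\<close>, so the square is
  obtained indirectly: multiplying the partition of unity by \<open>bary q\<close> and subtracting
  the \<open>d\<close> mixed integrals leaves it.\<close>

lemma integral_bary_square:
  assumes "q \<in> C"
  shows "(LINT x:convex hull C|lebesgue. bary q x * bary q x) = 2 * volume / ((real DIM('a) + 1) * (real DIM('a) + 2))"
proof -
  have int: "set_integrable lebesgue (convex hull C) (\<lambda>x. bary q x * bary r x)" for r
    by (intro set_integrable_hull continuous_intros continuous_bary)
  have "volume / (real DIM('a) + 1) = (LINT x:convex hull C|lebesgue. \<Sum>r\<in>C. bary q x * bary r x)"
    using integral_bary[OF assms] by (simp add: sum_distrib_left[symmetric] sum_bary)
  also have "\<dots> = (\<Sum>r\<in>C. LINT x:convex hull C|lebesgue. bary q x * bary r x)"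
    by (rule set_lebesgue_integral_sum) (rule int)
  also have "\<dots> = (LINT x:convex hull C|lebesgue. bary q x * bary q x)
      + (\<Sum>r\<in>C - {q}. LINT x:convex hull C|lebesgue. bary q x * bary r x)"
    by (rule sum.remove[OF finite_vertices assms])
  also have "(\<Sum>r\<in>C - {q}. LINT x:convex hull C|lebesgue. bary q x * bary r x)
      = real DIM('a) * (volume / ((real DIM('a) + 1) * (real DIM('a) + 2)))"
  proof -
    have "(\<Sum>r\<in>C - {q}. LINT x:convex hull C|lebesgue. bary q x * bary r x)
        = (\<Sum>r\<in>C - {q}. volume / ((real DIM('a) + 1) * (real DIM('a) + 2)))"
      using assms by (intro sum.cong refl integral_bary_mult) auto
    then show ?thesis using assms card_vertices by simp
  qed
  finally have "(LINT x:convex hull C|lebesgue. bary q x * bary q x)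
      = volume / (real DIM('a) + 1) - real DIM('a) * (volume / ((real DIM('a) + 1) * (real DIM('a) + 2)))" by simp
  also have "\<dots> = 2 * volume / ((real DIM('a) + 1) * (real DIM('a) + 2))"
  proof -
    define N where "N = (real DIM('a) + 1) * (real DIM('a) + 2)"
    have "volume / (real DIM('a) + 1) = (volume * (real DIM('a) + 2)) / N"
      unfolding N_def by (rule nonzero_mult_divide_mult_cancel_right[symmetric]) simp
    then have "volume / (real DIM('a) + 1) - real DIM('a) * (volume / N)
        = (volume * (real DIM('a) + 2) - real DIM('a) * volume) / N"
      by (simp add: diff_divide_distrib)
    also have "volume * (real DIM('a) + 2) - real DIM('a) * volume = 2 * volume"
      by (simp add: algebra_simps)
    finally show ?thesis by (simp add: N_def)
  qed
  finally show ?thesis .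
qed

lemma integral_affine:
  assumes "affine_on (convex hull C) u"
  shows "(LINT x:convex hull C|lebesgue. u x) = volume / (real DIM('a) + 1) * (\<Sum>q\<in>C. u q)"
proof -
  have "(LINT x:convex hull C|lebesgue. u x) = (LINT x:convex hull C|lebesgue. \<Sum>q\<in>C. u q * bary q x)"
    using affine_on_eq_sum_bary[OF assms] hull_sets
    by (intro set_lebesgue_integral_cong) auto
  also have "\<dots> = (\<Sum>q\<in>C. LINT x:convex hull C|lebesgue. u q * bary q x)"
    by (intro set_lebesgue_integral_sum set_integrable_hull continuous_intros continuous_bary)
  also have "\<dots> = (\<Sum>q\<in>C. u q * (volume / (real DIM('a) + 1)))"
    by (intro sum.cong refl) (simp add: integral_bary)
  finally show ?thesis by (simp add: sum_distrib_right sum_divide_distrib mult.commute)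
qed

lemma integral_affine_mult:
  assumes "affine_on (convex hull C) u" "affine_on (convex hull C) w"
  shows "(LINT x:convex hull C|lebesgue. u x * w x)
    = volume / ((real DIM('a) + 1) * (real DIM('a) + 2)) * ((\<Sum>q\<in>C. u q * w q) + (\<Sum>q\<in>C. u q) * (\<Sum>q\<in>C. w q))"
proof -
  define m where "m = volume / ((real DIM('a) + 1) * (real DIM('a) + 2))"
  have entry: "(LINT x:convex hull C|lebesgue. bary q x * bary r x) = m * (of_bool (q = r) + 1)"
    if "q \<in> C" "r \<in> C" for q r
    using that integral_bary_mult[of q r] integral_bary_square[of q] by (auto simp: m_def)
  have int: "set_integrable lebesgue (convex hull C) (\<lambda>x. (u q * w r) * (bary q x * bary r x))" for q r
    by (intro set_integrable_hull continuous_intros continuous_bary)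
  \<comment> \<open>The double sum is written over pairs so that the integral moves inside in one
    step.\<close>
  have "(LINT x:convex hull C|lebesgue. u x * w x)
      = (LINT x:convex hull C|lebesgue. \<Sum>p\<in>C \<times> C. (u (fst p) * w (snd p)) * (bary (fst p) x * bary (snd p) x))"
  proof (rule set_lebesgue_integral_cong)
    show "\<forall>x. x \<in> convex hull C \<longrightarrow> u x * w x = (\<Sum>p\<in>C \<times> C. (u (fst p) * w (snd p)) * (bary (fst p) x * bary (snd p) x))"
    proof (intro allI impI)
      fix x assume x: "x \<in> convex hull C"
      have "u x * w x = (\<Sum>q\<in>C. u q * bary q x) * (\<Sum>q\<in>C. w q * bary q x)"
        by (simp add: affine_on_eq_sum_bary[OF assms(1) x] affine_on_eq_sum_bary[OF assms(2) x])
      then show "u x * w x = (\<Sum>p\<in>C \<times> C. (u (fst p) * w (snd p)) * (bary (fst p) x * bary (snd p) x))"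
        by (simp add: sum_product sum.cartesian_product split_beta' ac_simps)
    qed
  qed (rule hull_sets)
  also have "\<dots> = (\<Sum>p\<in>C \<times> C. LINT x:convex hull C|lebesgue. (u (fst p) * w (snd p)) * (bary (fst p) x * bary (snd p) x))"
    by (intro set_lebesgue_integral_sum int)
  also have "\<dots> = (\<Sum>q\<in>C. \<Sum>r\<in>C. u q * w r * (m * (of_bool (q = r) + 1)))"
    unfolding sum.cartesian_product by (intro sum.cong refl) (auto simp: entry)
  also have "\<dots> = (\<Sum>q\<in>C. \<Sum>r\<in>C. m * (u q * w r * of_bool (q = r)) + m * (u q * w r))"
    by (simp add: algebra_simps)
  also have "\<dots> = m * ((\<Sum>q\<in>C. \<Sum>r\<in>C. u q * w r * of_bool (q = r)) + (\<Sum>q\<in>C. \<Sum>r\<in>C. u q * w r))"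
    by (simp only: sum.distrib sum_distrib_left distrib_left)
  also have "(\<Sum>q\<in>C. \<Sum>r\<in>C. u q * w r * of_bool (q = r)) = (\<Sum>q\<in>C. u q * w q)"
    using finite_vertices by (intro sum.cong refl) (simp add: of_bool_def if_distrib[of "\<lambda>c. _ * c"] cong: if_cong)
  also have "(\<Sum>q\<in>C. \<Sum>r\<in>C. u q * w r) = (\<Sum>q\<in>C. u q) * (\<Sum>q\<in>C. w q)"
    by (simp add: sum_product)
  finally show ?thesis unfolding m_def .
qed

text \<open>A nonempty convex set has nonempty relative interior, and here the affine hull is the
  whole space.\<close>

lemma interior_hull_nonempty: "interior (convex hull C) \<noteq> {}"
proof -
  have "convex hull C \<noteq> {}" using card_vertices by auto
  then have "rel_interior (convex hull C) \<noteq> {}"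
    using rel_interior_eq_empty[OF convex_convex_hull] by blast
  moreover have "affine hull (convex hull C) = UNIV"
    using affine_independent_span_eq[OF indep] card_vertices by simp
  ultimately show ?thesis by (simp add: rel_interior_interior)
qed

text \<open>Strict positivity makes the reference matrices nonzero and the lumped mass matrix
  invertible.\<close>

lemma volume_pos: "0 < volume"
proof -
  have "\<not> negligible (convex hull C)"
    using interior_hull_nonempty negligible_convex_interior[OF convex_convex_hull] by blast
  moreover have "convex hull C \<in> sets lborel"
    using compact_hull by (simp add: borel_compact)
  ultimately have "emeasure lborel (convex hull C) \<noteq> 0"
    by (auto simp: negligible_iff_null_sets null_sets_def)
  then have "volume \<noteq> 0" unfolding emeasure_hull by auto
  then show ?thesis by (simp add: less_le)
qed

end

section \<open>Piecewise linear functions on simplicial meshes\<close>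

text \<open>Extreme points depend on the set alone, without a choice of spanning points, and match
  \<open>mesh_vertices\<close>. For a simplex they are the affinely independent points that span
  it.\<close>

definition vertices :: "'a::euclidean_space set \<Rightarrow> 'a set" where
  "vertices \<tau> = {q. q extreme_point_of \<tau>}"

text \<open>Meant for integrands built from \<open>gradient\<close>, whose values on element
  boundaries are unspecified.\<close>

lemma set_lebesgue_integral_spike:
  fixes f g :: "'a::euclidean_space \<Rightarrow> real"
  assumes "set_integrable lebesgue S f" "negligible N" "\<And>x. x \<in> S - N \<Longrightarrow> g x = f x"
  shows "set_integrable lebesgue S g" "(LINT x:S|lebesgue. g x) = (LINT x:S|lebesgue. f x)"
proof -
  show g: "set_integrable lebesgue S g"
    by (rule absolutely_integrable_spike[OF assms])
  show "(LINT x:S|lebesgue. g x) = (LINT x:S|lebesgue. f x)"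
    using set_lebesgue_integral_eq_integral(2)[OF assms(1)] set_lebesgue_integral_eq_integral(2)[OF g]
      integral_spike[OF assms(2,3)] by simp
qed

lemma gradient_affine:
  assumes "x \<in> interior S" "\<And>y. y \<in> S \<Longrightarrow> f y = inner a y + b"
  shows "gradient f x = a"
proof -
  have "((\<lambda>y. inner a y + b) has_derivative (\<lambda>y. inner y a)) (at x)"
    by (auto intro!: derivative_eq_intros simp: inner_commute)
  then have "(f has_derivative (\<lambda>y. inner y a)) (at x)"
    by (rule has_derivative_transform_within_open[OF _ open_interior assms(1)])
      (use assms(2) interior_subset in force)
  then have a: "GDERIV f x :> a" by (simp add: gderiv_def)
  show ?thesis unfolding gradient_def
  proof (rule the_equality)
    fix D assume "GDERIV f x :> D"
    then have "(\<lambda>y. inner y D) = (\<lambda>y. inner y a)"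
      using a unfolding gderiv_def by (rule has_derivative_unique)
    then have "\<forall>y. inner y D = inner y a" by (simp add: fun_eq_iff)
    then show "D = a" unfolding vector_eq_ldot .
  qed (rule a)
qed

text \<open>In the interior both gradients are constant; the frontier, where they may fail to exist,
  is negligible because \<open>S\<close> is convex.\<close>

lemma integral_inner_gradient_affine:
  assumes "compact S" "convex S"
    and f: "\<And>y. y \<in> S \<Longrightarrow> f y = inner a y + b" and g: "\<And>y. y \<in> S \<Longrightarrow> g y = inner a' y + b'"
  shows "set_integrable lebesgue S (\<lambda>x. inner (gradient f x) (gradient g x))"
    and "(LINT x:S|lebesgue. inner (gradient f x) (gradient g x)) = measure lebesgue S * inner a a'"
proof -
  have int: "set_integrable lebesgue S (\<lambda>x. inner a a')"
    by (intro set_integrable_lebesgue_compact assms continuous_intros)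
  have neg: "negligible (frontier S)" by (rule negligible_convex_frontier[OF assms(2)])
  have eq: "inner (gradient f x) (gradient g x) = inner a a'" if "x \<in> S - frontier S" for x
  proof -
    have x: "x \<in> interior S" using that closure_subset by (auto simp: frontier_def)
    show ?thesis using gradient_affine[OF x f] gradient_affine[OF x g] by simp
  qed
  note spike = set_lebesgue_integral_spike[OF int neg eq]
  show "set_integrable lebesgue S (\<lambda>x. inner (gradient f x) (gradient g x))"
    using spike(1) by simp
  have "(LINT x:S|lebesgue. inner a a') = measure lebesgue S * inner a a'"
  proof -
    have "(LINT x:S|lebesgue. 1) = measure lebesgue S"
      using lmeasurable_compact[OF assms(1)] by (simp add: set_lebesgue_integral_def)
    then show ?thesis using set_integral_mult_right[of lebesgue S "inner a a'" "\<lambda>_. 1"] by simp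
  qed
  then show "(LINT x:S|lebesgue. inner (gradient f x) (gradient g x)) = measure lebesgue S * inner a a'"
    using spike(2) by simp
qed

section \<open>Conforming meshes of simplices\<close>

locale simplicial_mesh =
  fixes \<T> :: "(real^'d) set set"
  assumes triangulation: "triangulation \<T>"
    and full_dimensional: "\<And>\<tau>. \<tau> \<in> \<T> \<Longrightarrow> int CARD('d) simplex \<tau>"
begin

lemma finite_mesh: "finite \<T>"
  using triangulation by (simp add: triangulation_def)

lemma element:
  assumes "\<tau> \<in> \<T>"
  shows "full_simplex (vertices \<tau>)" "\<tau> = convex hull (vertices \<tau>)"
proof -
  obtain C where C: "\<not> affine_dependent C" "int (card C) = int CARD('d) + 1" "\<tau> = convex hull C"
    using full_dimensional[OF assms] unfolding simplex_def by blast
  then have "vertices \<tau> = C"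
    unfolding vertices_def using extreme_point_of_convex_hull_affine_independent[OF C(1)] by auto
  then show "full_simplex (vertices \<tau>)" "\<tau> = convex hull (vertices \<tau>)"
    using C by (auto simp: full_simplex_def)
qed

lemma finite_vertices: "\<tau> \<in> \<T> \<Longrightarrow> finite (vertices \<tau>)"
  using full_simplex.finite_vertices element(1) by blast

lemma card_vertices: "\<tau> \<in> \<T> \<Longrightarrow> card (vertices \<tau>) = CARD('d) + 1"
  using full_simplex.card_vertices element(1) by fastforce

lemma compact_element: "\<tau> \<in> \<T> \<Longrightarrow> compact \<tau>"
  using full_simplex.compact_hull[OF element(1), of \<tau>] by (simp flip: element(2))

lemma convex_element: "\<tau> \<in> \<T> \<Longrightarrow> convex \<tau>"
  using convex_convex_hull[of "vertices \<tau>"] by (simp flip: element(2))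

lemma element_sets: "\<tau> \<in> \<T> \<Longrightarrow> \<tau> \<in> sets lebesgue"
  using compact_element lmeasurable_compact by blast

lemma vertices_subset: "\<tau> \<in> \<T> \<Longrightarrow> vertices \<tau> \<subseteq> mesh_vertices \<T>"
  by (auto simp: vertices_def mesh_vertices_def)

lemma mesh_verticesE:
  assumes "q \<in> mesh_vertices \<T>"
  obtains \<tau> where "\<tau> \<in> \<T>" "q \<in> vertices \<tau>"
  using assms by (auto simp: vertices_def mesh_vertices_def)

lemma affine_on_eq_on_element:
  assumes "\<tau> \<in> \<T>" "affine_on \<tau> f" "affine_on \<tau> g" "\<And>q. q \<in> vertices \<tau> \<Longrightarrow> f q = g q" "x \<in> \<tau>"
  shows "f x = g x"
  using affine_on_eq_on_convex_hull[OF finite_vertices[OF assms(1)], of f g x] assms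
  by (simp flip: element(2))

lemma face_Int:
  assumes "\<tau> \<in> \<T>" "\<tau>' \<in> \<T>"
  shows "\<tau> \<inter> \<tau>' face_of \<tau>" "\<tau> \<inter> \<tau>' face_of \<tau>'"
proof -
  show "\<tau> \<inter> \<tau>' face_of \<tau>" using triangulation assms unfolding triangulation_def by blast
  have "\<tau>' \<inter> \<tau> face_of \<tau>'" using triangulation assms unfolding triangulation_def by blast
  then show "\<tau> \<inter> \<tau>' face_of \<tau>'" by (simp add: Int_commute)
qed

text \<open>Conformity at work: the intersection is a common face, its extreme points are the shared
  vertices, and by Krein-Milman it is their hull. Agreement at the shared vertices thus suffices,
  which lets affine pieces glue together.\<close>

lemma affine_on_eq_on_overlap:
  assumes \<tau>: "\<tau> \<in> \<T>" "\<tau>' \<in> \<T>" and aff: "affine_on \<tau> f" "affine_on \<tau>' g"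
    and eq: "\<And>q. q \<in> vertices \<tau> \<inter> vertices \<tau>' \<Longrightarrow> f q = g q" and x: "x \<in> \<tau>" "x \<in> \<tau>'"
  shows "f x = g x"
proof -
  let ?F = "\<tau> \<inter> \<tau>'"
  have verts: "vertices ?F = vertices \<tau> \<inter> vertices \<tau>'"
  proof -
    have "q \<in> vertices ?F \<longleftrightarrow> q \<in> vertices \<tau> \<inter> vertices \<tau>'" for q
      using extreme_point_of_face[OF face_Int(1)[OF \<tau>], of q] extreme_point_of_face[OF face_Int(2)[OF \<tau>], of q]
      unfolding vertices_def by (auto simp: extreme_point_of_def)
    then show ?thesis by blast
  qed
  have F: "?F = convex hull (vertices ?F)"
    unfolding vertices_def
    using compact_element[OF \<tau>(1)] compact_element[OF \<tau>(2)] convex_element[OF \<tau>(1)] convex_element[OF \<tau>(2)]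
    by (intro Krein_Milman_Minkowski compact_Int convex_Int)
  have "finite (vertices ?F)" using finite_vertices[OF \<tau>(1)] by (simp add: verts)
  moreover have "affine_on (convex hull (vertices ?F)) f" "affine_on (convex hull (vertices ?F)) g"
    unfolding F[symmetric] using aff affine_on_subset Int_lower1 Int_lower2 by blast+
  moreover have "x \<in> convex hull (vertices ?F)" using x F by blast
  ultimately show ?thesis using eq verts by (intro affine_on_eq_on_convex_hull[of "vertices ?F" f g x]) auto
qed

lemma negligible_overlap:
  assumes \<tau>: "\<tau> \<in> \<T>" "\<tau>' \<in> \<T>" and "\<tau> \<noteq> \<tau>'"
  shows "negligible (\<tau> \<inter> \<tau>')"
proof -
  have dims: "aff_dim \<tau> = int CARD('d)" "aff_dim \<tau>' = int CARD('d)"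
    using full_dimensional \<tau> aff_dim_simplex by blast+
  have "aff_dim (\<tau> \<inter> \<tau>') < int CARD('d)"
  \<comment> \<open>The intersection cannot be all of both elements. It is a proper face, hence of
    lower dimension, of one that it does not exhaust.\<close>
  proof (cases "\<tau> \<inter> \<tau>' = \<tau>")
    case True
    then have "\<tau> \<inter> \<tau>' \<noteq> \<tau>'" using assms(3) by simp
    then show ?thesis
      using face_of_aff_dim_lt[OF convex_element[OF \<tau>(2)] face_Int(2)[OF \<tau>]] dims by simp
  next
    case False
    then show ?thesis
      using face_of_aff_dim_lt[OF convex_element[OF \<tau>(1)] face_Int(1)[OF \<tau>]] dims by simp
  qed
  then have "interior (\<tau> \<inter> \<tau>') = {}"
    using aff_dim_nonempty_interior[of "\<tau> \<inter> \<tau>'"] by auto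
  moreover have "convex (\<tau> \<inter> \<tau>')" using \<tau> convex_element convex_Int by blast
  ultimately show ?thesis using negligible_convex_interior by blast
qed

lemma integral_Union_mesh:
  fixes f :: "real^'d \<Rightarrow> real"
  assumes "\<And>\<tau>. \<tau> \<in> \<T> \<Longrightarrow> set_integrable lebesgue \<tau> f"
  shows "(LINT x:\<Union>\<T>|lebesgue. f x) = (\<Sum>\<tau>\<in>\<T>. LINT x:\<tau>|lebesgue. f x)"
proof -
  have "AE x in lebesgue. x \<in> \<tau> \<and> x \<in> \<tau>' \<longrightarrow> \<tau> = \<tau>'" if "\<tau> \<in> \<T>" "\<tau>' \<in> \<T>" for \<tau> \<tau>'
  proof (cases "\<tau> = \<tau>'")
    case False
    then have "\<tau> \<inter> \<tau>' \<in> null_sets lebesgue"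
      using negligible_overlap[OF that] negligible_iff_null_sets by blast
    then have "AE x in lebesgue. x \<notin> \<tau> \<inter> \<tau>'" by (rule AE_not_in)
    then show ?thesis by eventually_elim auto
  qed simp
  then have "(LINT x:(\<Union>\<tau>\<in>\<T>. \<tau>)|lebesgue. f x) = (\<Sum>\<tau>\<in>\<T>. LINT x:\<tau>|lebesgue. f x)"
    using element_sets assms by (intro set_integral_finite_UN_AE finite_mesh) auto
  then show ?thesis by simp
qed

section \<open>Nodal interpolation and hat functions\<close>

lemma affine_on_p1: "w \<in> p1_functions \<T> \<Longrightarrow> \<tau> \<in> \<T> \<Longrightarrow> affine_on \<tau> w"
  by (simp add: p1_functions_def affine_on_def)

lemma p1_unique:
  assumes "w \<in> p1_functions \<T>" "w' \<in> p1_functions \<T>" "\<And>q. q \<in> mesh_vertices \<T> \<Longrightarrow> w q = w' q"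
  shows "w = w'"
proof
  fix x show "w x = w' x"
  proof (cases "x \<in> \<Union>\<T>")
    case True
    then obtain \<tau> where \<tau>: "\<tau> \<in> \<T>" "x \<in> \<tau>" by blast
    show ?thesis
    proof (rule affine_on_eq_on_element[OF \<tau>(1) affine_on_p1[OF assms(1) \<tau>(1)] affine_on_p1[OF assms(2) \<tau>(1)] _ \<tau>(2)])
      fix q assume "q \<in> vertices \<tau>"
      then show "w q = w' q" using vertices_subset[OF \<tau>(1)] assms(3) by auto
    qed
  next
    case False
    then show ?thesis using assms(1,2) by (simp add: p1_functions_def)
  qed
qed

text \<open>Each element gets its own affine interpolant, and a point is evaluated with an
  arbitrarily chosen element containing it. By \<open>affine_on_eq_on_overlap\<close> the choice is
  immaterial, and continuity follows from the finite closed cover.\<close>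

lemma p1_exists: "\<exists>w\<in>p1_functions \<T>. \<forall>q\<in>mesh_vertices \<T>. w q = f q"
proof -
  have "\<exists>g. affine_on UNIV g \<and> (\<forall>q\<in>vertices \<tau>. g q = f q)" if \<tau>: "\<tau> \<in> \<T>" for \<tau>
  proof -
    obtain g where "affine_on UNIV g" "\<And>q. q \<in> vertices \<tau> \<Longrightarrow> g q = f q"
      using affine_interpolation[OF full_simplex.indep[OF element(1)[OF \<tau>]], of f] by blast
    then show ?thesis by blast
  qed
  then have "\<forall>\<tau>\<in>\<T>. \<exists>g. affine_on UNIV g \<and> (\<forall>q\<in>vertices \<tau>. g q = f q)" by blast
  from bchoice[OF this] obtain g where g: "\<And>\<tau>. \<tau> \<in> \<T> \<Longrightarrow> affine_on UNIV (g \<tau>)"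
    "\<And>\<tau> q. \<tau> \<in> \<T> \<Longrightarrow> q \<in> vertices \<tau> \<Longrightarrow> g \<tau> q = f q"
    by blast
  define w where "w x = (if x \<in> \<Union>\<T> then g (SOME \<tau>. \<tau> \<in> \<T> \<and> x \<in> \<tau>) x else 0)" for x
  have w: "w x = g \<tau> x" if "\<tau> \<in> \<T>" "x \<in> \<tau>" for \<tau> x
  proof -
    define \<tau>' where "\<tau>' = (SOME \<tau>. \<tau> \<in> \<T> \<and> x \<in> \<tau>)"
    have "\<exists>\<tau>. \<tau> \<in> \<T> \<and> x \<in> \<tau>" using that by blast
    then have \<tau>': "\<tau>' \<in> \<T> \<and> x \<in> \<tau>'" unfolding \<tau>'_def by (rule someI_ex)
    have "w x = g \<tau>' x" using that by (auto simp: w_def \<tau>'_def)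
    also have "\<dots> = g \<tau> x"
    proof (rule affine_on_eq_on_overlap[of \<tau>' \<tau>])
      show "affine_on \<tau>' (g \<tau>')" "affine_on \<tau> (g \<tau>)"
        using \<tau>' that affine_on_subset[OF g(1) subset_UNIV] by blast+
    qed (use \<tau>' that g(2) in auto)
    finally show ?thesis .
  qed
  have aff: "affine_on \<tau> w" if "\<tau> \<in> \<T>" for \<tau>
    using g(1)[OF that] w[OF that] unfolding affine_on_def by auto
  have "continuous_on (\<Union>\<tau>\<in>\<T>. \<tau>) w"
    using finite_mesh compact_imp_closed[OF compact_element] continuous_on_affine_on[OF aff]
    by (intro continuous_on_closed_Union) auto
  then have "w \<in> p1_functions \<T>"
    using aff by (auto simp: p1_functions_def affine_on_def w_def)
  moreover have "w q = f q" if q: "q \<in> mesh_vertices \<T>" for q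
  proof -
    obtain \<tau> where \<tau>: "\<tau> \<in> \<T>" "q \<in> vertices \<tau>" using q by (rule mesh_verticesE)
    then have "q \<in> \<tau>" by (simp add: vertices_def extreme_point_of_def)
    then show ?thesis using w[OF \<tau>(1)] g(2)[OF \<tau>] by simp
  qed
  ultimately show ?thesis by blast
qed

lemma hat_p1: "hat \<T> q \<in> p1_functions \<T>"
  and hat_vertex: "r \<in> mesh_vertices \<T> \<Longrightarrow> hat \<T> q r = (if r = q then 1 else 0)"
proof -
  have "\<exists>!w. w \<in> p1_functions \<T> \<and> (\<forall>r\<in>mesh_vertices \<T>. w r = (if r = q then 1 else 0))"
  proof (rule ex_ex1I)
    show "\<exists>w. w \<in> p1_functions \<T> \<and> (\<forall>r\<in>mesh_vertices \<T>. w r = (if r = q then 1 else 0))"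
      using p1_exists[of "\<lambda>r. if r = q then 1 else 0"] by blast
  qed (auto intro: p1_unique)
  from theI'[OF this]
  show "hat \<T> q \<in> p1_functions \<T>"
    "r \<in> mesh_vertices \<T> \<Longrightarrow> hat \<T> q r = (if r = q then 1 else 0)"
    unfolding hat_def by blast+
qed

lemma affine_on_hat: "\<tau> \<in> \<T> \<Longrightarrow> affine_on \<tau> (hat \<T> q)"
  using affine_on_p1 hat_p1 by blast

text \<open>On an element both sides are affine and agree at the vertices. For \<open>q\<close>
  outside \<open>mesh_vertices \<T>\<close> the hat vanishes at every vertex, so further points in
  \<open>Q\<close> do no harm.\<close>

lemma sum_hat:
  assumes "finite Q" "mesh_vertices \<T> \<subseteq> Q" "x \<in> \<Union>\<T>"
  shows "(\<Sum>q\<in>Q. hat \<T> q x) = 1"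
proof -
  obtain \<tau> where \<tau>: "\<tau> \<in> \<T>" "x \<in> \<tau>" using assms(3) by blast
  show ?thesis
  proof (rule affine_on_eq_on_element[OF \<tau>(1), of "\<lambda>x. \<Sum>q\<in>Q. hat \<T> q x" "\<lambda>_. 1"])
    fix r assume "r \<in> vertices \<tau>"
    then have r: "r \<in> mesh_vertices \<T>" using vertices_subset[OF \<tau>(1)] by blast
    then have "(\<Sum>q\<in>Q. hat \<T> q r) = (\<Sum>q\<in>Q. if r = q then 1 else 0)"
      by (simp add: hat_vertex)
    also have "\<dots> = 1" using r assms by auto
    finally show "(\<Sum>q\<in>Q. hat \<T> q r) = 1" .
  next
    show "affine_on \<tau> (\<lambda>x. \<Sum>q\<in>Q. hat \<T> q x)"
      by (intro affine_on_sum affine_on_hat \<tau>)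
  qed (intro affine_on_const, rule \<tau>)
qed

lemma set_integrable_affine:
  "\<tau> \<in> \<T> \<Longrightarrow> affine_on \<tau> f \<Longrightarrow> set_integrable lebesgue \<tau> f"
  using set_integrable_lebesgue_compact[OF compact_element continuous_on_affine_on] by blast

lemma set_integrable_affine_mult:
  "\<tau> \<in> \<T> \<Longrightarrow> affine_on \<tau> f \<Longrightarrow> affine_on \<tau> g \<Longrightarrow> set_integrable lebesgue \<tau> (\<lambda>x. f x * g x)"
  by (intro set_integrable_lebesgue_compact compact_element continuous_on_mult continuous_on_affine_on)

lemma volume_pos:
  assumes "\<tau> \<in> \<T>"
  shows "0 < measure lebesgue \<tau>"
proof -
  have "\<tau> \<in> sets lborel" using compact_element[OF assms] by (simp add: borel_compact)
  then have "measure lebesgue \<tau> = measure lborel \<tau>" by simp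
  then show ?thesis
    using full_simplex.volume_pos[OF element(1)[OF assms]] assms by (simp flip: element(2))
qed

lemma integral_affine:
  assumes "\<tau> \<in> \<T>" "affine_on \<tau> u"
  shows "(LINT x:\<tau>|lebesgue. u x) = measure lebesgue \<tau> / (real CARD('d) + 1) * (\<Sum>q\<in>vertices \<tau>. u q)"
proof -
  have "\<tau> \<in> sets lborel" using compact_element[OF assms(1)] by (simp add: borel_compact)
  then have "measure lebesgue \<tau> = measure lborel \<tau>" by simp
  then show ?thesis
    using full_simplex.integral_affine[OF element(1)[OF assms(1)], of u] assms by (simp flip: element(2))
qed

lemma integral_affine_mult:
  assumes "\<tau> \<in> \<T>" "affine_on \<tau> u" "affine_on \<tau> w"
  shows "(LINT x:\<tau>|lebesgue. u x * w x) = measure lebesgue \<tau> / ((real CARD('d) + 1) * (real CARD('d) + 2))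
     * ((\<Sum>q\<in>vertices \<tau>. u q * w q) + (\<Sum>q\<in>vertices \<tau>. u q) * (\<Sum>q\<in>vertices \<tau>. w q))"
proof -
  have "\<tau> \<in> sets lborel" using compact_element[OF assms(1)] by (simp add: borel_compact)
  then have "measure lebesgue \<tau> = measure lborel \<tau>" by simp
  then show ?thesis
    using full_simplex.integral_affine_mult[OF element(1)[OF assms(1)], of u w] assms by (simp flip: element(2))
qed

text \<open>\<open>u\<close> is the interpolant of the square of \<open>w\<close>, and its integral
  is the lumped element form. In the notation of the proof the forms are \<open>c * (s + t)\<close>
  and \<open>c * (d + 2) * s\<close>, so the claim is \<open>0 \<le> t \<le> (d + 1) * s\<close>,
  the upper half being Cauchy-Schwarz over the \<open>d + 1\<close> vertices.\<close>

lemma mass_lumping_bounds: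
  assumes \<tau>: "\<tau> \<in> \<T>" and aff: "affine_on \<tau> u" "affine_on \<tau> w"
    and u: "\<And>q. q \<in> vertices \<tau> \<Longrightarrow> u q = w q * w q"
  shows "1 / (real CARD('d) + 2) * (LINT x:\<tau>|lebesgue. u x) \<le> (LINT x:\<tau>|lebesgue. w x * w x)"
    and "(LINT x:\<tau>|lebesgue. w x * w x) \<le> (LINT x:\<tau>|lebesgue. u x)"
proof -
  define d where "d = real CARD('d)"
  define s where "s = (\<Sum>q\<in>vertices \<tau>. w q * w q)"
  define t where "t = (\<Sum>q\<in>vertices \<tau>. w q) * (\<Sum>q\<in>vertices \<tau>. w q)"
  define c where "c = measure lebesgue \<tau> / ((d + 1) * (d + 2))"
  have d: "0 \<le> d" by (simp add: d_def)
  have c: "0 \<le> c" using d by (simp add: c_def)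
  have t: "0 \<le> t" "t \<le> (d + 1) * s"
    using sum_squared_le_sum_of_squares[of w "vertices \<tau>"] card_vertices[OF \<tau>]
    by (simp_all add: t_def s_def d_def power2_eq_square algebra_simps)
  have ww: "(LINT x:\<tau>|lebesgue. w x * w x) = c * (s + t)"
    using integral_affine_mult[OF \<tau> aff(2,2)] by (simp add: c_def d_def s_def t_def)
  have "(LINT x:\<tau>|lebesgue. u x) = measure lebesgue \<tau> / (d + 1) * s"
    using integral_affine[OF \<tau> aff(1)] u by (simp add: d_def s_def)
  also have "measure lebesgue \<tau> / (d + 1) = c * (d + 2)" using d by (simp add: c_def)
  finally have uu: "(LINT x:\<tau>|lebesgue. u x) = c * ((d + 2) * s)" by simp
  have "1 / (d + 2) * (LINT x:\<tau>|lebesgue. u x) = c * s" using d by (simp add: uu)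
  also have "\<dots> \<le> c * (s + t)" using t c by (intro mult_left_mono) auto
  finally show "1 / (real CARD('d) + 2) * (LINT x:\<tau>|lebesgue. u x) \<le> (LINT x:\<tau>|lebesgue. w x * w x)"
    by (simp add: ww d_def)
  have "c * (s + t) \<le> c * ((d + 2) * s)" using t c by (intro mult_left_mono) (auto simp: algebra_simps)
  then show "(LINT x:\<tau>|lebesgue. w x * w x) \<le> (LINT x:\<tau>|lebesgue. u x)"
    by (simp add: ww uu)
qed

end

section \<open>Passing from the domain to its mesh\<close>

lemma negligible_frontier_polyhedrally_bounded:
  fixes \<Omega> :: "(real^'d) set"
  assumes "polyhedrally_bounded \<Omega>"
  shows "negligible (frontier \<Omega>)"
proof -
  obtain \<F> where F: "finite \<F>" "\<And>F. F \<in> \<F> \<Longrightarrow> polytope F" "\<And>F. F \<in> \<F> \<Longrightarrow> aff_dim F = int CARD('d) - 1"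
    "frontier \<Omega> = \<Union>\<F>"
    using assms unfolding polyhedrally_bounded_def by blast
  have "negligible F" if "F \<in> \<F>" for F
  proof -
    have "interior F = {}" using aff_dim_nonempty_interior[of F] F(3)[OF that] by auto
    then show ?thesis using negligible_convex_interior[OF polytope_imp_convex[OF F(2)[OF that]]] by blast
  qed
  then show ?thesis using F(1,4) by auto
qed

locale domain_mesh =
  fixes \<Omega> :: "(real^'d) set" and \<T> :: "(real^'d) set set"
  assumes open_domain: "open \<Omega>" and polyhedral: "polyhedrally_bounded \<Omega>"
    and admissible: "admissible_mesh \<Omega> \<T>"

sublocale domain_mesh \<subseteq> simplicial_mesh \<T>
  using admissible by unfold_locales (auto simp: admissible_mesh_def)

context domain_mesh
begin

lemma domain_subset: "\<Omega> \<subseteq> \<Union>\<T>"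
  using admissible closure_subset by (auto simp: admissible_mesh_def)

text \<open>The elements tile the closure. For an open domain the surplus lies in the frontier,
  which could have positive measure in general but is negligible for a polyhedral boundary.\<close>

lemma integral_domain:
  fixes f :: "real^'d \<Rightarrow> real"
  assumes "\<And>\<tau>. \<tau> \<in> \<T> \<Longrightarrow> set_integrable lebesgue \<tau> f"
  shows "set_integrable lebesgue \<Omega> f"
    and "(LINT x:\<Omega>|lebesgue. f x) = (\<Sum>\<tau>\<in>\<T>. LINT x:\<tau>|lebesgue. f x)"
proof -
  have \<Omega>: "\<Omega> \<in> sets lebesgue" using open_domain by (simp add: borel_open)
  have U: "set_integrable lebesgue (\<Union>\<T>) f"
    using set_integrable_UN[of \<T> lebesgue "\<lambda>\<tau>. \<tau>" f] assms element_sets finite_mesh by simp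
  show int: "set_integrable lebesgue \<Omega> f"
    by (rule set_integrable_subset[OF U \<Omega> domain_subset])
  have "\<Union>\<T> - \<Omega> \<subseteq> frontier \<Omega>"
    using admissible open_domain by (auto simp: admissible_mesh_def frontier_def interior_open)
  then have "\<Union>\<T> - \<Omega> \<in> null_sets lebesgue"
    using negligible_subset[OF negligible_frontier_polyhedrally_bounded[OF polyhedral]]
    by (simp only: negligible_iff_null_sets)
  then have "AE x in lebesgue. x \<notin> \<Union>\<T> - \<Omega>" by (rule AE_not_in)
  then have "AE x in lebesgue. x \<in> \<Union>\<T> \<longleftrightarrow> x \<in> \<Omega>"
  proof eventually_elim
    case (elim x)
    then show ?case using domain_subset by blast
  qed
  then have "(LINT x:\<Omega>|lebesgue. f x) = (LINT x:\<Union>\<T>|lebesgue. f x)"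
    using U int unfolding set_integrable_def
    by (intro set_integral_cong_set) (auto simp: set_borel_measurable_def)
  then show "(LINT x:\<Omega>|lebesgue. f x) = (\<Sum>\<tau>\<in>\<T>. LINT x:\<tau>|lebesgue. f x)"
    using integral_Union_mesh[OF assms] by simp
qed

end

section \<open>The reference element\<close>

lemma unit_simplex_affine_independent: "\<not> affine_dependent (insert 0 (Basis :: 'a::euclidean_space set))"
  using affine_dependent_iff_dependent[of 0 "Basis :: 'a set"] independent_Basis nonzero_Basis by auto

lemma card_insert_0_Basis: "card (insert 0 (Basis :: 'a::euclidean_space set)) = DIM('a) + 1"
  using nonzero_Basis by (subst card_insert_disjoint) auto

text \<open>Regarding the unit simplex as a mesh with one element makes the general facts on hats
  and element integrals available for \<open>ref_basis\<close>.\<close>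

interpretation reference: simplicial_mesh "{unit_simplex :: (real^'d) set}"
proof
  have "int CARD('d) simplex (unit_simplex :: (real^'d) set)"
    unfolding simplex_def unit_simplex_def
    using unit_simplex_affine_independent[where 'a = "real^'d"] card_insert_0_Basis[where 'a = "real^'d"]
    by (intro exI[of _ "insert 0 Basis"]) auto
  then show "int CARD('d) simplex \<tau>" if "\<tau> \<in> {unit_simplex :: (real^'d) set}" for \<tau>
    using that by simp
  then show "triangulation {unit_simplex :: (real^'d) set}"
    unfolding triangulation_def by (auto simp: unit_simplex_def intro: face_of_refl)
qed

lemma vertices_unit_simplex: "vertices (unit_simplex :: (real^'d) set) = insert 0 Basis"
  unfolding vertices_def unit_simplex_def
  using extreme_point_of_convex_hull_affine_independent[OF unit_simplex_affine_independent] by auto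

lemma mesh_vertices_unit_simplex: "mesh_vertices {unit_simplex :: (real^'d) set} = insert 0 Basis"
  using vertices_unit_simplex by (auto simp: mesh_vertices_def vertices_def)

lemma bij_betw_ref_vertex: "bij_betw ref_vertex {..<CARD('d) + 1} (insert 0 Basis :: (real^'d) set)"
proof -
  have "bij_betw (from_nat_into (UNIV :: 'd set)) {..<CARD('d)} UNIV"
    by (rule bij_betw_from_nat_into_finite) simp
  moreover have "bij_betw (\<lambda>i. axis i 1 :: real^'d) UNIV Basis"
    by (auto simp: bij_betw_def inj_on_def axis_eq_axis Basis_vec_def)
  ultimately have "bij_betw (\<lambda>k. axis (from_nat_into UNIV k) 1 :: real^'d) {..<CARD('d)} Basis"
    using bij_betw_trans by (fastforce simp: o_def)
  \<comment> \<open>Undoes the shift in \<open>ref_vertex\<close>, whose index 0 is reserved for the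
    origin.\<close>
  moreover have "bij_betw (\<lambda>k. k - 1) {1..<CARD('d) + 1} {..<CARD('d)}"
    by (rule bij_betwI[of _ _ _ Suc]) auto
  ultimately have "bij_betw ((\<lambda>k. axis (from_nat_into UNIV k) 1 :: real^'d) \<circ> (\<lambda>k. k - 1)) {1..<CARD('d) + 1} Basis"
    by (rule bij_betw_trans[rotated])
  then have "bij_betw ref_vertex {1..<CARD('d) + 1} (Basis :: (real^'d) set)"
    by (rule bij_betw_cong[THEN iffD1, rotated]) (auto simp: ref_vertex_def)
  moreover have "bij_betw ref_vertex {0} {0 :: real^'d}" by (simp add: ref_vertex_def bij_betw_def)
  ultimately have "bij_betw ref_vertex ({0} \<union> {1..<CARD('d) + 1}) ({0} \<union> Basis :: (real^'d) set)"
    using nonzero_Basis by (intro bij_betw_combine) auto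
  moreover have "{0} \<union> {1..<CARD('d) + 1} = {..<CARD('d) + 1}" by auto
  ultimately show ?thesis by simp
qed

lemma ref_basis_vertex:
  assumes "i < CARD('d) + 1" "j < CARD('d) + 1"
  shows "ref_basis i (ref_vertex j :: real^'d) = of_bool (i = j)"
proof -
  have "ref_vertex j \<in> (insert 0 Basis :: (real^'d) set)"
    using bij_betw_ref_vertex[where 'd = 'd] assms bij_betwE by blast
  moreover have "ref_vertex j = (ref_vertex i :: real^'d) \<longleftrightarrow> j = i"
    using bij_betw_ref_vertex[where 'd = 'd] assms by (auto simp: bij_betw_def inj_on_eq_iff)
  ultimately show ?thesis
    unfolding ref_basis_def by (simp add: reference.hat_vertex mesh_vertices_unit_simplex)
qed

lemma integral_ref_basis_mult:
  assumes "i < CARD('d) + 1" "j < CARD('d) + 1"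
  shows "(LINT x:unit_simplex|lebesgue. ref_basis j x * ref_basis i (x :: real^'d))
       = measure lebesgue (unit_simplex :: (real^'d) set) / ((real CARD('d) + 1) * (real CARD('d) + 2)) * (of_bool (i = j) + 1)"
proof -
  have sum: "(\<Sum>q\<in>vertices unit_simplex. f q) = (\<Sum>k<CARD('d) + 1. f (ref_vertex k))" for f :: "real^'d \<Rightarrow> real"
    unfolding vertices_unit_simplex by (rule sum.reindex_bij_betw[OF bij_betw_ref_vertex, symmetric])
  have aff: "affine_on (unit_simplex :: (real^'d) set) (ref_basis k)" for k
    unfolding ref_basis_def by (rule reference.affine_on_hat) simp
  have "(\<Sum>k<CARD('d) + 1. ref_basis l (ref_vertex k :: real^'d)) = 1" if "l < CARD('d) + 1" for l
  proof -
    have "(\<Sum>k<CARD('d) + 1. ref_basis l (ref_vertex k :: real^'d)) = (\<Sum>k<CARD('d) + 1. of_bool (l = k))"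
      using ref_basis_vertex[OF that] by (intro sum.cong) auto
    also have "\<dots> = 1" using that by (simp add: of_bool_def)
    finally show ?thesis .
  qed
  moreover have "(\<Sum>k<CARD('d) + 1. ref_basis j (ref_vertex k :: real^'d) * ref_basis i (ref_vertex k :: real^'d)) = of_bool (i = j)"
  proof -
    have "(\<Sum>k<CARD('d) + 1. ref_basis j (ref_vertex k :: real^'d) * ref_basis i (ref_vertex k :: real^'d))
        = (\<Sum>k<CARD('d) + 1. if j = k then of_bool (i = j) else 0)"
      using ref_basis_vertex[where 'd = 'd] assms by (intro sum.cong) auto
    also have "\<dots> = of_bool (i = j)" using assms by simp
    finally show ?thesis .
  qed
  ultimately show ?thesis
    using reference.integral_affine_mult[OF _ aff aff, of j i] assms unfolding sum by simp
qed

text \<open>With \<open>s\<close> the sum of the entries, the equation reads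
  \<open>v_i + s = \<mu> * (N + 1) * v_i\<close>. If \<open>s = 0\<close>, a nonzero entry forces
  \<open>\<mu> = 1 / (N + 1)\<close>; otherwise summing over \<open>i\<close> gives
  \<open>(N + 1) * s = \<mu> * (N + 1) * s\<close>, so \<open>\<mu> = 1\<close>. The bound
  \<open>2 \<le> N\<close> provides a nonzero vector with \<open>s = 0\<close>.\<close>

lemma generalized_eigenvalues_reference:
  fixes m :: real
  assumes N: "2 \<le> N" and m: "0 < m"
  shows "generalized_eigenvalues (mat N N (\<lambda>(i, j). m * (of_bool (i = j) + 1)))
      (mat N N (\<lambda>(i, j). if i = j then m * (real N + 1) else 0)) = {1 / (real N + 1), 1}"
proof -
  let ?A = "mat N N (\<lambda>(i, j). m * (of_bool (i = j) + 1))"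
  let ?B = "mat N N (\<lambda>(i, j). if i = j then m * (real N + 1) else 0)"
  have A: "vec_index (?A *\<^sub>v v) i = m * (vec_index v i + (\<Sum>k<N. vec_index v k))"
    if "i < N" "v \<in> carrier_vec N" for v i
  proof -
    have "vec_index (?A *\<^sub>v v) i = (\<Sum>k<N. m * (of_bool (i = k) + 1) * vec_index v k)"
      using that by (simp add: scalar_prod_def lessThan_atLeast0)
    also have "\<dots> = m * ((\<Sum>k<N. if i = k then vec_index v k else 0) + (\<Sum>k<N. vec_index v k))"
      unfolding sum.distrib[symmetric] sum_distrib_left by (intro sum.cong) (auto simp: algebra_simps)
    also have "(\<Sum>k<N. if i = k then vec_index v k else 0) = vec_index v i" using that by simp
    finally show ?thesis .
  qed
  have B: "vec_index (?B *\<^sub>v v) i = m * (real N + 1) * vec_index v i"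
    if "i < N" "v \<in> carrier_vec N" for v i
  proof -
    have "vec_index (?B *\<^sub>v v) i = (\<Sum>k<N. (if i = k then m * (real N + 1) else 0) * vec_index v k)"
      using that by (simp add: scalar_prod_def lessThan_atLeast0)
    also have "\<dots> = (\<Sum>k<N. if i = k then m * (real N + 1) * vec_index v k else 0)"
      by (intro sum.cong) auto
    also have "\<dots> = m * (real N + 1) * vec_index v i" using that by simp
    finally show ?thesis .
  qed
  have eig: "?A *\<^sub>v v = \<mu> \<cdot>\<^sub>v (?B *\<^sub>v v) \<longleftrightarrow>
      (\<forall>i<N. vec_index v i + (\<Sum>k<N. vec_index v k) = \<mu> * (real N + 1) * vec_index v i)"
    if v: "v \<in> carrier_vec N" for v \<mu>
  proof -
    have "?A *\<^sub>v v = \<mu> \<cdot>\<^sub>v (?B *\<^sub>v v) \<longleftrightarrow> (\<forall>i<N. vec_index (?A *\<^sub>v v) i = \<mu> * vec_index (?B *\<^sub>v v) i)"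
      by (auto simp: vec_eq_iff)
    also have "\<dots> \<longleftrightarrow> (\<forall>i<N. m * (vec_index v i + (\<Sum>k<N. vec_index v k)) = m * (\<mu> * (real N + 1) * vec_index v i))"
      using A[OF _ v] B[OF _ v] by (simp add: ac_simps)
    also have "\<dots> \<longleftrightarrow> (\<forall>i<N. vec_index v i + (\<Sum>k<N. vec_index v k) = \<mu> * (real N + 1) * vec_index v i)"
      using m by simp
    finally show ?thesis .
  qed
  show ?thesis
  proof (intro equalityI subsetI)
    fix \<mu> assume "\<mu> \<in> generalized_eigenvalues ?A ?B"
    then obtain v where v: "v \<in> carrier_vec N" "v \<noteq> 0\<^sub>v N" "?A *\<^sub>v v = \<mu> \<cdot>\<^sub>v (?B *\<^sub>v v)"
      unfolding generalized_eigenvalues_def by auto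
    define s where "s = (\<Sum>k<N. vec_index v k)"
    have e: "vec_index v i + s = \<mu> * (real N + 1) * vec_index v i" if "i < N" for i
      using v(3) that unfolding eig[OF v(1)] s_def by blast
    show "\<mu> \<in> {1 / (real N + 1), 1}"
    proof (cases "s = 0")
      case True
      have "\<exists>i<N. vec_index v i \<noteq> 0"
      proof (rule ccontr)
        assume "\<not> (\<exists>i<N. vec_index v i \<noteq> 0)"
        then have "v = 0\<^sub>v N" using v(1) by (intro eq_vecI) auto
        then show False using v(2) by simp
      qed
      then obtain i where i: "i < N" "vec_index v i \<noteq> 0" by blast
      then have "\<mu> * (real N + 1) = 1" using e[OF i(1)] True by simp
      then show ?thesis by (simp add: field_simps)
    next
      case False
      have "(real N + 1) * s = (\<Sum>i<N. vec_index v i + s)"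
        by (simp add: sum.distrib s_def[symmetric] algebra_simps)
      also have "\<dots> = (\<Sum>i<N. \<mu> * (real N + 1) * vec_index v i)"
        using e by (intro sum.cong) auto
      also have "\<dots> = \<mu> * ((real N + 1) * s)"
        by (simp add: s_def sum_distrib_left mult.assoc)
      finally have "(real N + 1) * s = \<mu> * ((real N + 1) * s)" .
      moreover have "(real N + 1) * s \<noteq> 0" using False by simp
      ultimately have "\<mu> = 1" by (metis mult_cancel_right1)
      then show ?thesis by simp
    qed
  next
    fix \<mu> assume \<mu>: "\<mu> \<in> {1 / (real N + 1), 1}"
    have "\<exists>v\<in>carrier_vec N. v \<noteq> 0\<^sub>v N \<and>
        (\<forall>i<N. vec_index v i + (\<Sum>k<N. vec_index v k) = \<mu> * (real N + 1) * vec_index v i)"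
    proof (cases "\<mu> = 1")
      case True
      define v :: "real Matrix.vec" where "v = Matrix.vec N (\<lambda>_. 1)"
      have "vec_index v 0 \<noteq> vec_index (0\<^sub>v N) 0" using N by (simp add: v_def)
      then have "v \<noteq> 0\<^sub>v N" by auto
      then show ?thesis using True by (intro bexI[of _ v]) (auto simp: v_def)
    next
      case False
      then have \<mu>: "\<mu> * (real N + 1) = 1" using \<mu> by auto
      \<comment> \<open>Difference of the first two unit vectors, the simplest nonzero vector whose
        entries sum to zero.\<close>
      define v :: "real Matrix.vec" where "v = Matrix.vec N (\<lambda>i. of_bool (i = 0) - of_bool (i = 1))"
      have "vec_index v 0 \<noteq> vec_index (0\<^sub>v N) 0" using N by (simp add: v_def)
      then have "v \<noteq> 0\<^sub>v N" by auto
      moreover have "(\<Sum>k<N. vec_index v k) = 0"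
      proof -
        have "(\<Sum>k<N. vec_index v k) = (\<Sum>k<N. if k = 0 then 1 else 0) - (\<Sum>k<N. if k = 1 then 1 else 0)"
          unfolding sum_subtractf[symmetric] by (intro sum.cong) (auto simp: v_def)
        then show ?thesis using N by simp
      qed
      ultimately show ?thesis using \<mu> by (intro bexI[of _ v]) (auto simp: v_def)
    qed
    then obtain v where v: "v \<in> carrier_vec N" "v \<noteq> 0\<^sub>v N"
      "\<forall>i<N. vec_index v i + (\<Sum>k<N. vec_index v k) = \<mu> * (real N + 1) * vec_index v i" by blast
    have "?A *\<^sub>v v = \<mu> \<cdot>\<^sub>v (?B *\<^sub>v v)" unfolding eig[OF v(1)] by (rule v(3))
    then show "\<mu> \<in> generalized_eigenvalues ?A ?B"
      unfolding generalized_eigenvalues_def using v(1,2) by auto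
  qed
qed

text \<open>All row sums of the reference mass matrix equal \<open>m * (N + 1)\<close> with
  \<open>N = d + 1\<close>, so lumping yields a multiple of the identity.\<close>

lemma lambda_ref_values:
  shows "lambda_min_ref TYPE('d::finite) = 1 / (real CARD('d) + 2)" and "lambda_max_ref TYPE('d) = 1"
proof -
  define N where "N = CARD('d) + 1"
  define m where "m = measure lebesgue (unit_simplex :: (real^'d) set) / ((real CARD('d) + 1) * (real CARD('d) + 2))"
  have m: "0 < m" unfolding m_def using reference.volume_pos[where 'd = 'd] by simp
  have N: "2 \<le> N" unfolding N_def by (simp add: Suc_le_eq)
  have M: "ref_mass_mat TYPE('d) = mat N N (\<lambda>(i, j). m * (of_bool (i = j) + 1))"
    unfolding ref_mass_mat_def mass_mat_def N_def
    by (intro cong_mat refl) (simp add: integral_ref_basis_mult m_def)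
  have L: "ref_lumped_mass_mat TYPE('d) = mat N N (\<lambda>(i, j). if i = j then m * (real N + 1) else 0)"
    unfolding ref_lumped_mass_mat_def lumped_mass_mat_def N_def
  proof (intro cong_mat refl)
    fix i j assume "i < CARD('d) + 1" "j < CARD('d) + 1"
    then have "(\<Sum>k<CARD('d) + 1. LINT x:unit_simplex|lebesgue. ref_basis k x * ref_basis i (x :: real^'d))
        = (\<Sum>k<CARD('d) + 1. m * ((if i = k then 1 else 0) + 1))"
      by (intro sum.cong refl) (simp add: integral_ref_basis_mult m_def of_bool_def)
    also have "\<dots> = m * ((\<Sum>k<CARD('d) + 1. if i = k then 1 else 0) + (\<Sum>k<CARD('d) + 1. 1))"
      by (simp only: sum_distrib_left[symmetric] sum.distrib)
    also have "(\<Sum>k<CARD('d) + 1. if i = k then 1 else 0) = (1 :: real)"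
      using \<open>i < CARD('d) + 1\<close> by simp
    finally show "(case (i, j) of (i, j) \<Rightarrow> if i = j
        then \<Sum>k<CARD('d) + 1. LINT x:unit_simplex|lebesgue. ref_basis k x * ref_basis i (x :: real^'d) else 0)
      = (case (i, j) of (i, j) \<Rightarrow> if i = j then m * (real (CARD('d) + 1) + 1) else 0)"
      by (cases "i = j") simp_all
  qed
  have E: "generalized_eigenvalues (ref_mass_mat TYPE('d)) (ref_lumped_mass_mat TYPE('d)) = {1 / (real N + 1), 1}"
    unfolding M L by (rule generalized_eigenvalues_reference[OF N m])
  have "1 / (real N + 1) \<le> 1" by simp
  then show "lambda_min_ref TYPE('d) = 1 / (real CARD('d) + 2)" "lambda_max_ref TYPE('d) = 1"
    unfolding lambda_min_ref_def lambda_max_ref_def E by (auto simp: N_def min_def max_def)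
qed

section \<open>Matrix inequalities\<close>

text \<open>The degenerate case \<open>c = 0\<close> has to be covered because the lemma serves
  forms that are only semidefinite.\<close>

lemma quadratic_nonneg_imp_discriminant:
  fixes a b c :: real
  assumes "\<And>t. 0 \<le> a + 2 * t * b + t\<^sup>2 * c" "0 \<le> c"
  shows "b\<^sup>2 \<le> a * c"
proof (cases "c = 0")
  case True
  have "b = 0"
  proof (rule ccontr)
    assume "b \<noteq> 0"
    \<comment> \<open>The point at which the nonconstant affine function of \<open>t\<close> takes
      the value -1.\<close>
    then have "a + 2 * (- (a + 1) / (2 * b)) * b = - 1" by (simp add: field_simps)
    then show False using assms(1)[of "- (a + 1) / (2 * b)"] True by simp
  qed
  then show ?thesis using True by simp
next
  case False
  then have c: "0 < c" using assms(2) by simp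
  \<comment> \<open>Evaluation at the minimiser \<open>t = - b / c\<close>.\<close>
  have "a + 2 * (- b / c) * b + (- b / c)\<^sup>2 * c = a - b\<^sup>2 / c"
    using c by (simp add: field_simps power2_eq_square)
  then have "b\<^sup>2 / c \<le> a" using assms(1)[of "- b / c"] by simp
  then show ?thesis using c by (simp add: divide_le_eq)
qed

lemma symmetric_scalar_prod:
  fixes K :: "real mat"
  assumes "K \<in> carrier_mat n n" "transpose_mat K = K" "v \<in> carrier_vec n" "w \<in> carrier_vec n"
  shows "scalar_prod (K *\<^sub>v v) w = scalar_prod v (K *\<^sub>v w)"
  using transpose_vec_mult_scalar[OF assms(1,4,3)] assms(2) by simp

text \<open>The form at \<open>v + t w\<close> is a nonnegative quadratic polynomial in
  \<open>t\<close>; symmetry merges its two mixed terms.\<close>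

lemma psd_cauchy_schwarz:
  fixes K :: "real mat"
  assumes K: "K \<in> carrier_mat n n" and sym: "transpose_mat K = K"
    and psd: "\<And>v. v \<in> carrier_vec n \<Longrightarrow> 0 \<le> scalar_prod (K *\<^sub>v v) v"
    and v: "v \<in> carrier_vec n" and w: "w \<in> carrier_vec n"
  shows "(scalar_prod (K *\<^sub>v v) w)\<^sup>2 \<le> scalar_prod (K *\<^sub>v v) v * scalar_prod (K *\<^sub>v w) w"
proof (rule quadratic_nonneg_imp_discriminant)
  fix t :: real
  have Kv: "K *\<^sub>v v \<in> carrier_vec n" and Kw: "K *\<^sub>v w \<in> carrier_vec n"
    using K v w by auto
  have "scalar_prod (K *\<^sub>v w) v = scalar_prod (K *\<^sub>v v) w"
    using symmetric_scalar_prod[OF K sym w v] comm_scalar_prod[OF w Kv] by simp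
  moreover have "K *\<^sub>v (v + t \<cdot>\<^sub>v w) = K *\<^sub>v v + t \<cdot>\<^sub>v (K *\<^sub>v w)"
    using K v w by (simp add: mult_add_distrib_mat_vec mult_mat_vec)
  ultimately have "scalar_prod (K *\<^sub>v (v + t \<cdot>\<^sub>v w)) (v + t \<cdot>\<^sub>v w)
      = scalar_prod (K *\<^sub>v v) v + 2 * t * scalar_prod (K *\<^sub>v v) w + t\<^sup>2 * scalar_prod (K *\<^sub>v w) w"
    using v w Kv Kw
    by (simp add: add_scalar_prod_distrib[of _ n] scalar_prod_add_distrib[of _ n] power2_eq_square algebra_simps)
  then show "0 \<le> scalar_prod (K *\<^sub>v v) v + 2 * t * scalar_prod (K *\<^sub>v v) w + t\<^sup>2 * scalar_prod (K *\<^sub>v w) w"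
    using psd[of "v + t \<cdot>\<^sub>v w"] v w by simp
qed (rule psd[OF w])

lemma smult_mat_quadratic_form:
  fixes A :: "real mat"
  assumes "A \<in> carrier_mat n n" "v \<in> carrier_vec n"
  shows "scalar_prod ((c \<cdot>\<^sub>m A) *\<^sub>v v) v = c * scalar_prod (A *\<^sub>v v) v"
proof -
  have "(c \<cdot>\<^sub>m A) *\<^sub>v v = c \<cdot>\<^sub>v (A *\<^sub>v v)" using assms by (intro eq_vecI) auto
  then show ?thesis using assms by simp
qed

lemma smult_mat_le:
  assumes "A \<in> carrier_mat n n" "B \<in> carrier_mat n n" "transpose_mat A = A" "transpose_mat B = B"
    and "\<And>v. v \<in> carrier_vec n \<Longrightarrow> c * scalar_prod (A *\<^sub>v v) v \<le> d * scalar_prod (B *\<^sub>v v) v"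
  shows "c \<cdot>\<^sub>m A \<preceq>\<^sub>m d \<cdot>\<^sub>m B"
proof -
  have "transpose_mat (c \<cdot>\<^sub>m A) = c \<cdot>\<^sub>m transpose_mat A" "transpose_mat (d \<cdot>\<^sub>m B) = d \<cdot>\<^sub>m transpose_mat B"
    by (intro eq_matI; auto)+
  then show ?thesis
    unfolding mat_le_def using assms smult_mat_quadratic_form[of _ n] by (intro exI[of _ n]) auto
qed

text \<open>\<open>mat_inv\<close> strips an option, so \<open>mat_inverse\<close> must first be
  shown to succeed: the explicit inverse \<open>E\<close> makes \<open>D\<close> a unit. The
  returned matrix \<open>B\<close> is then \<open>E\<close> because
  \<open>B = B (D E) = (B D) E\<close>.\<close>

lemma
  assumes "\<And>i. i < n \<Longrightarrow> d i \<noteq> 0"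
  shows mat_inv_diagonal: "mat_inv (mat n n (\<lambda>(i, j). if i = j then d i else 0))
       = mat n n (\<lambda>(i, j). if i = j then 1 / d i else 0)"
    and diagonal_mult_mat_inv: "mat n n (\<lambda>(i, j). if i = j then d i else 0)
       * mat_inv (mat n n (\<lambda>(i, j). if i = j then d i else 0)) = 1\<^sub>m n"
proof -
  define D where "D = mat n n (\<lambda>(i, j). if i = j then d i else 0)"
  define E where "E = mat n n (\<lambda>(i, j). if i = j then 1 / d i else 0)"
  have D: "D \<in> carrier_mat n n" and E: "E \<in> carrier_mat n n" by (auto simp: D_def E_def)
  have prod: "mat n n (\<lambda>(i, j). if i = j then f i else 0) * mat n n (\<lambda>(i, j). if i = j then g i else 0) = 1\<^sub>m n"
    if "\<And>i. i < n \<Longrightarrow> f i * g i = 1" for f g :: "nat \<Rightarrow> real"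
  proof (rule eq_matI)
    fix i j assume ij: "i < dim_row (1\<^sub>m n :: real mat)" "j < dim_col (1\<^sub>m n :: real mat)"
    have "(\<Sum>k = 0..<n. (if i = k then f i else 0) * (if k = j then g k else 0))
        = (\<Sum>k = 0..<n. if k = i then (if i = j then f i * g i else 0) else 0)"
      by (intro sum.cong) auto
    also have "\<dots> = (if i = j then 1 else 0)" using ij that by simp
    finally show "(mat n n (\<lambda>(i, j). if i = j then f i else 0) * mat n n (\<lambda>(i, j). if i = j then g i else 0)) $$ (i, j)
      = (1\<^sub>m n :: real mat) $$ (i, j)"
      using ij by (simp add: scalar_prod_def)
  qed auto
  have DE: "D * E = 1\<^sub>m n" and ED: "E * D = 1\<^sub>m n"
    unfolding D_def E_def using assms by (auto intro!: prod)
  then have "D \<in> Units (ring_mat TYPE(real) n ())"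
    using D E unfolding Units_def ring_mat_def by auto
  then obtain B where B: "mat_inverse D = Some B"
    using mat_inverse(1)[OF D, where b = "()"] by (cases "mat_inverse D") auto
  then have "B * D = 1\<^sub>m n" "B \<in> carrier_mat n n" using mat_inverse(2)[OF D B] by auto
  then have "B = E"
    using DE D E assoc_mult_mat[of B n n D n E n] by simp
  then have inv: "mat_inv D = E" using B by (simp add: mat_inv_def)
  show "mat_inv (mat n n (\<lambda>(i, j). if i = j then d i else 0))
       = mat n n (\<lambda>(i, j). if i = j then 1 / d i else 0)"
    using inv unfolding D_def E_def .
  show "mat n n (\<lambda>(i, j). if i = j then d i else 0)
       * mat_inv (mat n n (\<lambda>(i, j). if i = j then d i else 0)) = 1\<^sub>m n"
    using DE inv unfolding D_def by simp
qed

text \<open>Pure matrix algebra, with \<open>\<kappa>\<close> in the role of the squared inverse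
  constant. Symmetry of \<open>schur_mat\<close> is proved along the way because
  \<open>\<preceq>\<^sub>m\<close> includes it.\<close>

lemma schur_mat_bounds:
  fixes K D M :: "real mat"
  assumes K: "K \<in> carrier_mat n n" and symK: "transpose_mat K = K"
    and M: "M \<in> carrier_mat n n" and symM: "transpose_mat M = M"
    and D: "D \<in> carrier_mat n n"
    and E: "mat_inv D \<in> carrier_mat n n" and symE: "transpose_mat (mat_inv D) = mat_inv D"
    and DE: "D * mat_inv D = 1\<^sub>m n"
    and K_psd: "\<And>v. v \<in> carrier_vec n \<Longrightarrow> 0 \<le> scalar_prod (K *\<^sub>v v) v"
    and K_le: "\<And>v. v \<in> carrier_vec n \<Longrightarrow> scalar_prod (K *\<^sub>v v) v \<le> \<kappa> * scalar_prod (M *\<^sub>v v) v"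
    and M_psd: "\<And>v. v \<in> carrier_vec n \<Longrightarrow> 0 \<le> scalar_prod (M *\<^sub>v v) v"
    and M_le: "\<And>v. v \<in> carrier_vec n \<Longrightarrow> scalar_prod (M *\<^sub>v v) v \<le> scalar_prod (D *\<^sub>v v) v"
    and \<kappa>: "0 \<le> \<kappa>" and \<rho>: "0 \<le> \<rho>"
  shows "M \<preceq>\<^sub>m schur_mat \<rho> K D M" and "schur_mat \<rho> K D M \<preceq>\<^sub>m (\<rho> * \<kappa>\<^sup>2 + 1) \<cdot>\<^sub>m M"
proof -
  let ?E = "mat_inv D" and ?S = "schur_mat \<rho> K D M"
  have KEK: "K * ?E * K \<in> carrier_mat n n" using K E by simp
  have "transpose_mat (K * ?E * K) = transpose_mat K * (transpose_mat ?E * transpose_mat K)"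
    by (simp only: transpose_mult[OF mult_carrier_mat[OF K E] K] transpose_mult[OF K E])
  also have "\<dots> = K * ?E * K"
    using K E by (simp add: symK symE)
  finally have "transpose_mat (K * ?E * K) = K * ?E * K" .
  moreover have "transpose_mat (\<rho> \<cdot>\<^sub>m (K * ?E * K)) = \<rho> \<cdot>\<^sub>m transpose_mat (K * ?E * K)"
    by (intro eq_matI) auto
  ultimately have symS: "transpose_mat ?S = ?S"
    unfolding schur_mat_def using KEK M by (subst transpose_add[of _ n n]) (auto simp: symM)
  have S: "?S \<in> carrier_mat n n" unfolding schur_mat_def using KEK M by simp
  have form: "scalar_prod (?S *\<^sub>v v) v = \<rho> * scalar_prod ((K * ?E * K) *\<^sub>v v) v + scalar_prod (M *\<^sub>v v) v"
    if v: "v \<in> carrier_vec n" for v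
  proof -
    have "?S *\<^sub>v v = (\<rho> \<cdot>\<^sub>m (K * ?E * K)) *\<^sub>v v + M *\<^sub>v v"
      unfolding schur_mat_def using KEK M v by (intro add_mult_distrib_mat_vec) auto
    then have "scalar_prod (?S *\<^sub>v v) v = scalar_prod ((\<rho> \<cdot>\<^sub>m (K * ?E * K)) *\<^sub>v v) v + scalar_prod (M *\<^sub>v v) v"
      using add_scalar_prod_distrib[OF mult_mat_vec_carrier[OF smult_carrier_mat[OF KEK] v]
          mult_mat_vec_carrier[OF M v] v] by simp
    then show ?thesis using smult_mat_quadratic_form[OF KEK v] by simp
  qed
  have bounds: "0 \<le> scalar_prod ((K * ?E * K) *\<^sub>v v) v"
    "scalar_prod ((K * ?E * K) *\<^sub>v v) v \<le> \<kappa>\<^sup>2 * scalar_prod (M *\<^sub>v v) v"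
    if v: "v \<in> carrier_vec n" for v
  proof -
    define w where "w = ?E *\<^sub>v (K *\<^sub>v v)"
    have Kv: "K *\<^sub>v v \<in> carrier_vec n" and w: "w \<in> carrier_vec n" using K E v by (auto simp: w_def)
    have Dw: "D *\<^sub>v w = K *\<^sub>v v"
      unfolding w_def using assoc_mult_mat_vec[OF D E Kv] DE Kv by simp
    \<comment> \<open>with \<open>w = D\<^sup>-\<^sup>1 K v\<close>, the quantity \<open>s = (K D\<^sup>-\<^sup>1 K v, v)\<close> equals both \<open>(K v, w)\<close> and \<open>(D w, w)\<close>\<close>
    define s where "s = scalar_prod (K *\<^sub>v v) w"
    have "(K * ?E * K) *\<^sub>v v = K *\<^sub>v w"
      unfolding w_def by (simp only: assoc_mult_mat_vec[OF mult_carrier_mat[OF K E] K v] assoc_mult_mat_vec[OF K E Kv])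
    then have s: "scalar_prod ((K * ?E * K) *\<^sub>v v) v = s"
      unfolding s_def using symmetric_scalar_prod[OF K symK w v] comm_scalar_prod[OF w Kv] by simp
    have Mw: "scalar_prod (M *\<^sub>v w) w \<le> s" using M_le[OF w] Dw by (simp add: s_def)
    then have s0: "0 \<le> s" using M_psd[OF w] by linarith
    have "s\<^sup>2 \<le> scalar_prod (K *\<^sub>v v) v * scalar_prod (K *\<^sub>v w) w"
      unfolding s_def by (rule psd_cauchy_schwarz[OF K symK K_psd v w])
    also have "\<dots> \<le> (\<kappa> * scalar_prod (M *\<^sub>v v) v) * (\<kappa> * s)"
    proof (rule mult_mono)
      show "scalar_prod (K *\<^sub>v w) w \<le> \<kappa> * s"
        using K_le[OF w] mult_left_mono[OF Mw \<kappa>] by linarith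
    qed (use K_le[OF v] K_psd[OF w] M_psd[OF v] \<kappa> in auto)
    finally have "s * s \<le> (\<kappa>\<^sup>2 * scalar_prod (M *\<^sub>v v) v) * s"
      by (simp add: power2_eq_square ac_simps)
    \<comment> \<open>One factor \<open>s\<close> is cancelled; for \<open>s = 0\<close> the bound
      is just nonnegativity of the mass form.\<close>
    then have "s \<le> \<kappa>\<^sup>2 * scalar_prod (M *\<^sub>v v) v"
      using s0 M_psd[OF v] by (cases "s = 0") (auto simp: mult_le_cancel_right)
    then show "0 \<le> scalar_prod ((K * ?E * K) *\<^sub>v v) v"
      "scalar_prod ((K * ?E * K) *\<^sub>v v) v \<le> \<kappa>\<^sup>2 * scalar_prod (M *\<^sub>v v) v"
      using s s0 by auto
  qed
  have "scalar_prod (M *\<^sub>v v) v \<le> scalar_prod (?S *\<^sub>v v) v" if "v \<in> carrier_vec n" for v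
    using form[OF that] mult_nonneg_nonneg[OF \<rho> bounds(1)[OF that]] by simp
  then show "M \<preceq>\<^sub>m ?S" unfolding mat_le_def using M S symM symS by blast
  have "scalar_prod (?S *\<^sub>v v) v \<le> (\<rho> * \<kappa>\<^sup>2 + 1) * scalar_prod (M *\<^sub>v v) v" if "v \<in> carrier_vec n" for v
    using form[OF that] mult_left_mono[OF bounds(2)[OF that] \<rho>] by (simp add: algebra_simps)
  then have "1 \<cdot>\<^sub>m ?S \<preceq>\<^sub>m (\<rho> * \<kappa>\<^sup>2 + 1) \<cdot>\<^sub>m M" by (intro smult_mat_le[OF S M symS symM]) simp
  moreover have "1 \<cdot>\<^sub>m ?S = ?S" by (intro eq_matI) auto
  ultimately show "?S \<preceq>\<^sub>m (\<rho> * \<kappa>\<^sup>2 + 1) \<cdot>\<^sub>m M" by simp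
qed

section \<open>Finite element matrices\<close>

lemma quadratic_form_mat:
  assumes "v \<in> carrier_vec n"
  shows "scalar_prod (mat n n f *\<^sub>v v) v = (\<Sum>i<n. \<Sum>j<n. f (i, j) * vec_index v j * (vec_index v i :: real))"
  using assms by (simp add: scalar_prod_def lessThan_atLeast0 sum_distrib_right)

locale fe_mesh = domain_mesh \<Omega> \<T> for \<Omega> :: "(real^'d) set" and \<T> +
  fixes p :: "nat \<Rightarrow> real^'d" and n nbar :: nat
  assumes numbering: "node_numbering \<Omega> \<T> p n nbar"
begin

abbreviation \<phi> :: "nat \<Rightarrow> real^'d \<Rightarrow> real" where
  "\<phi> j \<equiv> hat \<T> (p j)"

text \<open>Coefficients are an arbitrary function of the index, so that besides
  \<open>vec_index v\<close> its entrywise square can be inserted.\<close>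

definition fe_function :: "(nat \<Rightarrow> real) \<Rightarrow> real^'d \<Rightarrow> real" where
  "fe_function c x = (\<Sum>j<n. c j * \<phi> j x)"

lemma n_le_nbar: "n \<le> nbar"
  using numbering by (simp add: node_numbering_def)

lemma bij_nodes: "bij_betw p {..<nbar} (mesh_vertices \<T>)"
  using numbering by (simp add: node_numbering_def)

lemma affine_on_fe_function: "\<tau> \<in> \<T> \<Longrightarrow> affine_on \<tau> (fe_function c)"
  unfolding fe_function_def by (intro affine_on_sum affine_on_cmult affine_on_hat)

lemma fe_function_node:
  assumes "k < nbar"
  shows "fe_function c (p k) = (if k < n then c k else 0)"
proof -
  have "p k \<in> mesh_vertices \<T>" using bij_nodes assms bij_betwE by blast
  moreover have "p k = p j \<longleftrightarrow> k = j" if "j < n" for j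
    using bij_nodes assms that n_le_nbar by (auto simp: bij_betw_def inj_on_eq_iff)
  ultimately have "fe_function c (p k) = (\<Sum>j<n. if k = j then c j else 0)"
    unfolding fe_function_def by (intro sum.cong) (auto simp: hat_vertex)
  then show ?thesis by simp
qed

text \<open>At boundary vertices both sides vanish. Squared coefficients therefore give the
  interpolant of the square on every element, as \<open>mass_lumping_bounds\<close>
  requires.\<close>

lemma fe_function_square_vertex:
  assumes "\<tau> \<in> \<T>" "q \<in> vertices \<tau>"
  shows "fe_function (\<lambda>j. c j * c j) q = fe_function c q * fe_function c q"
proof -
  have "q \<in> mesh_vertices \<T>" using assms vertices_subset by blast
  then obtain k where "k < nbar" "q = p k" using bij_nodes by (auto simp: bij_betw_def)
  then show ?thesis by (simp add: fe_function_node)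
qed

lemma integral_domain_hat_mult:
  "set_integrable lebesgue \<Omega> (\<lambda>x. \<phi> j x * \<phi> i x)"
  "(LINT x:\<Omega>|lebesgue. \<phi> j x * \<phi> i x) = (\<Sum>\<tau>\<in>\<T>. LINT x:\<tau>|lebesgue. \<phi> j x * \<phi> i x)"
  by (rule integral_domain; intro set_integrable_affine_mult affine_on_hat; assumption)+

section \<open>Quadratic forms of the matrices as sums over elements\<close>

lemma mass_form:
  assumes "v \<in> carrier_vec n"
  shows "scalar_prod (mass_mat \<Omega> n \<phi> *\<^sub>v v) v
       = (\<Sum>\<tau>\<in>\<T>. LINT x:\<tau>|lebesgue. fe_function (vec_index v) x * fe_function (vec_index v) x)"
proof -
  let ?c = "vec_index v"
  have elem: "(LINT x:\<tau>|lebesgue. fe_function ?c x * fe_function ?c x)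
      = (\<Sum>i<n. \<Sum>j<n. (LINT x:\<tau>|lebesgue. \<phi> j x * \<phi> i x) * ?c j * ?c i)" if \<tau>: "\<tau> \<in> \<T>" for \<tau>
  proof -
    have int: "set_integrable lebesgue \<tau> (\<lambda>x. ?c i * ?c j * (\<phi> j x * \<phi> i x))" for i j
      using set_integrable_affine_mult[OF \<tau> affine_on_hat[OF \<tau>] affine_on_hat[OF \<tau>]]
      by (intro set_integrable_mult_right) auto
    have "(LINT x:\<tau>|lebesgue. fe_function ?c x * fe_function ?c x)
        = (LINT x:\<tau>|lebesgue. \<Sum>p\<in>{..<n} \<times> {..<n}. ?c (fst p) * ?c (snd p) * (\<phi> (snd p) x * \<phi> (fst p) x))"
      unfolding fe_function_def sum_product sum.cartesian_product by (simp add: split_beta' ac_simps)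
    also have "\<dots> = (\<Sum>p\<in>{..<n} \<times> {..<n}. LINT x:\<tau>|lebesgue. ?c (fst p) * ?c (snd p) * (\<phi> (snd p) x * \<phi> (fst p) x))"
      by (intro set_lebesgue_integral_sum int)
    also have "\<dots> = (\<Sum>i<n. \<Sum>j<n. (LINT x:\<tau>|lebesgue. \<phi> j x * \<phi> i x) * ?c j * ?c i)"
      unfolding sum.cartesian_product by (intro sum.cong refl) (auto simp: ac_simps)
    finally show ?thesis .
  qed
  have "scalar_prod (mass_mat \<Omega> n \<phi> *\<^sub>v v) v
      = (\<Sum>i<n. \<Sum>j<n. \<Sum>\<tau>\<in>\<T>. (LINT x:\<tau>|lebesgue. \<phi> j x * \<phi> i x) * ?c j * ?c i)"
    unfolding mass_mat_def quadratic_form_mat[OF assms]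
    by (simp add: integral_domain_hat_mult(2) sum_distrib_right)
  also have "\<dots> = (\<Sum>i<n. \<Sum>\<tau>\<in>\<T>. \<Sum>j<n. (LINT x:\<tau>|lebesgue. \<phi> j x * \<phi> i x) * ?c j * ?c i)"
    by (intro sum.cong refl sum.swap)
  also have "\<dots> = (\<Sum>\<tau>\<in>\<T>. \<Sum>i<n. \<Sum>j<n. (LINT x:\<tau>|lebesgue. \<phi> j x * \<phi> i x) * ?c j * ?c i)"
    by (rule sum.swap)
  finally show ?thesis by (simp add: elem)
qed

text \<open>\<open>gradient\<close> is a definite description, hence linear only where the functions
  are differentiable. Bilinearity is therefore derived from the constant coefficients
  \<open>a j\<close> of the hats on one element.\<close>

lemma
  shows integral_domain_inner_gradient_hat: "(LINT x:\<Omega>|lebesgue. inner (gradient (\<phi> j) x) (gradient (\<phi> i) x))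
      = (\<Sum>\<tau>\<in>\<T>. LINT x:\<tau>|lebesgue. inner (gradient (\<phi> j) x) (gradient (\<phi> i) x))"
    and element_stiffness_form: "\<tau> \<in> \<T> \<Longrightarrow>
      (LINT x:\<tau>|lebesgue. inner (gradient (fe_function c) x) (gradient (fe_function c) x))
      = (\<Sum>i<n. \<Sum>j<n. (LINT x:\<tau>|lebesgue. inner (gradient (\<phi> j) x) (gradient (\<phi> i) x)) * c j * c i)"
proof -
  have coeffs: "\<exists>a b. \<forall>j. \<forall>x\<in>\<tau>. \<phi> j x = inner (a j) x + b j" if "\<tau> \<in> \<T>" for \<tau>
  proof -
    have "\<forall>j. \<exists>ab. \<forall>x\<in>\<tau>. \<phi> j x = inner (fst ab) x + snd ab"
      using affine_on_hat[OF that] by (auto simp: affine_on_def)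
    from choice[OF this] obtain ab where "\<forall>j. \<forall>x\<in>\<tau>. \<phi> j x = inner (fst (ab j)) x + snd (ab j)" ..
    then show ?thesis by (intro exI[of _ "\<lambda>j. fst (ab j)"] exI[of _ "\<lambda>j. snd (ab j)"])
  qed
  show "(LINT x:\<Omega>|lebesgue. inner (gradient (\<phi> j) x) (gradient (\<phi> i) x))
      = (\<Sum>\<tau>\<in>\<T>. LINT x:\<tau>|lebesgue. inner (gradient (\<phi> j) x) (gradient (\<phi> i) x))"
  proof (rule integral_domain(2))
    fix \<tau> assume \<tau>: "\<tau> \<in> \<T>"
    then obtain a b where ab: "\<forall>j. \<forall>x\<in>\<tau>. \<phi> j x = inner (a j) x + b j" using coeffs by blast
    show "set_integrable lebesgue \<tau> (\<lambda>x. inner (gradient (\<phi> j) x) (gradient (\<phi> i) x))"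
      by (rule integral_inner_gradient_affine(1)[OF compact_element[OF \<tau>] convex_element[OF \<tau>]])
        (use ab in blast)+
  qed
  show "(LINT x:\<tau>|lebesgue. inner (gradient (fe_function c) x) (gradient (fe_function c) x))
      = (\<Sum>i<n. \<Sum>j<n. (LINT x:\<tau>|lebesgue. inner (gradient (\<phi> j) x) (gradient (\<phi> i) x)) * c j * c i)"
    if \<tau>: "\<tau> \<in> \<T>"
  proof -
    obtain a b where ab: "\<forall>j. \<forall>x\<in>\<tau>. \<phi> j x = inner (a j) x + b j" using coeffs[OF \<tau>] by blast
    note int = integral_inner_gradient_affine(2)[OF compact_element[OF \<tau>] convex_element[OF \<tau>]]
    have w: "fe_function c x = inner (\<Sum>j<n. c j *\<^sub>R a j) x + (\<Sum>j<n. c j * b j)" if "x \<in> \<tau>" for x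
    proof -
      have "fe_function c x = (\<Sum>j<n. c j * inner (a j) x + c j * b j)"
        unfolding fe_function_def using ab that by (intro sum.cong) (auto simp: distrib_left)
      then show ?thesis by (simp add: sum.distrib inner_sum_left)
    qed
    have entry: "(LINT x:\<tau>|lebesgue. inner (gradient (\<phi> j) x) (gradient (\<phi> i) x))
        = measure lebesgue \<tau> * inner (a j) (a i)" for i j
      by (rule int) (use ab in blast)+
    have "(LINT x:\<tau>|lebesgue. inner (gradient (fe_function c) x) (gradient (fe_function c) x))
        = measure lebesgue \<tau> * inner (\<Sum>j<n. c j *\<^sub>R a j) (\<Sum>j<n. c j *\<^sub>R a j)"
      by (rule int[OF w w])
    also have "\<dots> = (\<Sum>i<n. \<Sum>j<n. measure lebesgue \<tau> * inner (a j) (a i) * c j * c i)"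
      by (simp add: inner_sum_left inner_sum_right sum_distrib_left ac_simps inner_commute)
    finally show ?thesis by (simp add: entry)
  qed
qed

lemma stiffness_form:
  assumes "v \<in> carrier_vec n"
  shows "scalar_prod (stiffness_mat \<Omega> n \<phi> *\<^sub>v v) v
    = (\<Sum>\<tau>\<in>\<T>. LINT x:\<tau>|lebesgue. inner (gradient (fe_function (vec_index v)) x) (gradient (fe_function (vec_index v)) x))"
proof -
  let ?c = "vec_index v"
  let ?k = "\<lambda>\<tau> i j. LINT x:\<tau>|lebesgue. inner (gradient (\<phi> j) x) (gradient (\<phi> i) x)"
  have "scalar_prod (stiffness_mat \<Omega> n \<phi> *\<^sub>v v) v = (\<Sum>i<n. \<Sum>j<n. \<Sum>\<tau>\<in>\<T>. ?k \<tau> i j * ?c j * ?c i)"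
    unfolding stiffness_mat_def quadratic_form_mat[OF assms]
    by (simp add: integral_domain_inner_gradient_hat sum_distrib_right)
  also have "\<dots> = (\<Sum>i<n. \<Sum>\<tau>\<in>\<T>. \<Sum>j<n. ?k \<tau> i j * ?c j * ?c i)"
    by (intro sum.cong refl sum.swap)
  also have "\<dots> = (\<Sum>\<tau>\<in>\<T>. \<Sum>i<n. \<Sum>j<n. ?k \<tau> i j * ?c j * ?c i)"
    by (rule sum.swap)
  finally show ?thesis by (simp add: element_stiffness_form)
qed

text \<open>All \<open>nbar\<close> hats sum to 1 on the domain, so each row sum collapses to the
  integral of one hat.\<close>

lemma lumped_mass_mat_diagonal:
  "lumped_mass_mat \<Omega> n nbar \<phi> = mat n n (\<lambda>(i, j). if i = j then LINT x:\<Omega>|lebesgue. \<phi> i x else 0)"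
proof -
  have row_sum: "(\<Sum>k<nbar. LINT x:\<Omega>|lebesgue. \<phi> k x * \<phi> i x) = (LINT x:\<Omega>|lebesgue. \<phi> i x)" for i
  proof -
    have "(\<Sum>k<nbar. LINT x:\<Omega>|lebesgue. \<phi> k x * \<phi> i x) = (LINT x:\<Omega>|lebesgue. \<Sum>k<nbar. \<phi> k x * \<phi> i x)"
      by (intro set_lebesgue_integral_sum[symmetric] integral_domain_hat_mult)
    also have "\<dots> = (LINT x:\<Omega>|lebesgue. \<phi> i x)"
    proof (rule set_lebesgue_integral_cong)
      show "\<Omega> \<in> sets lebesgue" using open_domain by (simp add: borel_open)
      show "\<forall>x. x \<in> \<Omega> \<longrightarrow> (\<Sum>k<nbar. \<phi> k x * \<phi> i x) = \<phi> i x"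
      proof (intro allI impI)
        fix x assume "x \<in> \<Omega>"
        then have x: "x \<in> \<Union>\<T>" using domain_subset by blast
        have "(\<Sum>k<nbar. \<phi> k x) = (\<Sum>q\<in>mesh_vertices \<T>. hat \<T> q x)"
          by (rule sum.reindex_bij_betw[OF bij_nodes])
        also have "\<dots> = 1"
          using sum_hat[of "mesh_vertices \<T>", OF _ order_refl x] bij_betw_finite[OF bij_nodes] by simp
        finally show "(\<Sum>k<nbar. \<phi> k x * \<phi> i x) = \<phi> i x"
          by (simp add: sum_distrib_right[symmetric])
      qed
    qed
    finally show ?thesis .
  qed
  show ?thesis unfolding lumped_mass_mat_def row_sum ..
qed

lemma integral_domain_hat: "(LINT x:\<Omega>|lebesgue. \<phi> i x) = (\<Sum>\<tau>\<in>\<T>. LINT x:\<tau>|lebesgue. \<phi> i x)"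
  by (rule integral_domain) (intro set_integrable_affine affine_on_hat)

text \<open>With diagonal entries equal to integrals of hats, the weighted sum of squares is the
  integral of the hats combined with squared coefficients.\<close>

lemma lumped_mass_form:
  assumes "v \<in> carrier_vec n"
  shows "scalar_prod (lumped_mass_mat \<Omega> n nbar \<phi> *\<^sub>v v) v
    = (\<Sum>\<tau>\<in>\<T>. LINT x:\<tau>|lebesgue. fe_function (\<lambda>j. vec_index v j * vec_index v j) x)"
proof -
  let ?c = "\<lambda>j. vec_index v j * vec_index v j"
  have "scalar_prod (lumped_mass_mat \<Omega> n nbar \<phi> *\<^sub>v v) v
      = (\<Sum>i<n. \<Sum>j<n. if i = j then (LINT x:\<Omega>|lebesgue. \<phi> i x) * ?c i else 0)"
    unfolding lumped_mass_mat_diagonal quadratic_form_mat[OF assms] by (intro sum.cong) auto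
  also have "\<dots> = (\<Sum>i<n. \<Sum>\<tau>\<in>\<T>. (LINT x:\<tau>|lebesgue. ?c i * \<phi> i x))"
    by (intro sum.cong refl) (simp add: integral_domain_hat sum_distrib_left mult.commute)
  also have "\<dots> = (\<Sum>\<tau>\<in>\<T>. \<Sum>i<n. (LINT x:\<tau>|lebesgue. ?c i * \<phi> i x))" by (rule sum.swap)
  also have "\<dots> = (\<Sum>\<tau>\<in>\<T>. LINT x:\<tau>|lebesgue. fe_function ?c x)"
    unfolding fe_function_def
    by (intro sum.cong refl set_lebesgue_integral_sum[symmetric] set_integrable_affine affine_on_cmult affine_on_hat)
  finally show ?thesis .
qed

text \<open>Every element having \<open>p i\<close> as a vertex contributes
  \<open>1 / (d + 1)\<close> of its volume, the others nothing, and at least one such element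
  exists. This makes the diagonal of the lumped matrix invertible.\<close>

lemma integral_hat_pos:
  assumes "i < n"
  shows "0 < (LINT x:\<Omega>|lebesgue. \<phi> i x)"
proof -
  have elem: "(LINT x:\<tau>|lebesgue. \<phi> i x)
      = measure lebesgue \<tau> / (real CARD('d) + 1) * (if p i \<in> vertices \<tau> then 1 else 0)" if \<tau>: "\<tau> \<in> \<T>" for \<tau>
  proof -
    have "(\<Sum>q\<in>vertices \<tau>. \<phi> i q) = (\<Sum>q\<in>vertices \<tau>. if q = p i then 1 else 0)"
      using vertices_subset[OF \<tau>] by (intro sum.cong) (auto simp: hat_vertex)
    then show ?thesis
      using integral_affine[OF \<tau> affine_on_hat[OF \<tau>]] finite_vertices[OF \<tau>] by simp
  qed
  have "p i \<in> mesh_vertices \<T>" using bij_nodes assms n_le_nbar bij_betwE by fastforce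
  then obtain \<tau> where \<tau>: "\<tau> \<in> \<T>" "p i \<in> vertices \<tau>" by (rule mesh_verticesE)
  have "0 < (\<Sum>\<tau>\<in>\<T>. LINT x:\<tau>|lebesgue. \<phi> i x)"
  proof (rule sum_pos2[OF finite_mesh \<tau>(1)])
    show "0 < (LINT x:\<tau>|lebesgue. \<phi> i x)"
      using volume_pos[OF \<tau>(1)] \<tau>(2) by (simp add: elem[OF \<tau>(1)] add_nonneg_pos)
  qed (simp add: elem)
  then show ?thesis by (simp add: integral_domain_hat)
qed

lemma mass_psd: "v \<in> carrier_vec n \<Longrightarrow> 0 \<le> scalar_prod (mass_mat \<Omega> n \<phi> *\<^sub>v v) v"
  unfolding mass_form set_lebesgue_integral_def
  by (intro sum_nonneg Bochner_Integration.integral_nonneg) simp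

lemma stiffness_psd: "v \<in> carrier_vec n \<Longrightarrow> 0 \<le> scalar_prod (stiffness_mat \<Omega> n \<phi> *\<^sub>v v) v"
  unfolding stiffness_form set_lebesgue_integral_def
  by (intro sum_nonneg Bochner_Integration.integral_nonneg) simp

lemma mass_lumped_bounds:
  assumes "v \<in> carrier_vec n"
  shows "1 / (real CARD('d) + 2) * scalar_prod (lumped_mass_mat \<Omega> n nbar \<phi> *\<^sub>v v) v
      \<le> scalar_prod (mass_mat \<Omega> n \<phi> *\<^sub>v v) v"
    and "scalar_prod (mass_mat \<Omega> n \<phi> *\<^sub>v v) v \<le> scalar_prod (lumped_mass_mat \<Omega> n nbar \<phi> *\<^sub>v v) v"
  unfolding mass_form[OF assms] lumped_mass_form[OF assms] sum_distrib_left
  by (intro sum_mono mass_lumping_bounds affine_on_fe_function fe_function_square_vertex; assumption)+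

lemma stiffness_le_mass:
  assumes inverse_ineq: "\<And>w \<tau>. w \<in> fe_space n \<phi> \<Longrightarrow> \<tau> \<in> \<T> \<Longrightarrow>
      L2_norm_on \<tau> (gradient w) \<le> c * L2_norm_on \<tau> w"
    and v: "v \<in> carrier_vec n" and c: "0 \<le> c"
  shows "scalar_prod (stiffness_mat \<Omega> n \<phi> *\<^sub>v v) v \<le> c\<^sup>2 * scalar_prod (mass_mat \<Omega> n \<phi> *\<^sub>v v) v"
proof -
  let ?w = "fe_function (vec_index v)"
  have "(LINT x:\<tau>|lebesgue. inner (gradient ?w x) (gradient ?w x)) \<le> c\<^sup>2 * (LINT x:\<tau>|lebesgue. ?w x * ?w x)"
    if \<tau>: "\<tau> \<in> \<T>" for \<tau>
  proof -
    have "?w \<in> fe_space n \<phi>"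
      unfolding fe_space_def by (intro CollectI exI[of _ "vec_index v"]) (simp add: fe_function_def fun_eq_iff)
    then have "L2_norm_on \<tau> (gradient ?w) \<le> c * L2_norm_on \<tau> ?w" by (rule inverse_ineq[OF _ \<tau>])
    moreover have "0 \<le> L2_norm_on \<tau> (gradient ?w)"
      unfolding L2_norm_on_def set_lebesgue_integral_def by (intro real_sqrt_ge_zero Bochner_Integration.integral_nonneg) simp
    ultimately have "(L2_norm_on \<tau> (gradient ?w))\<^sup>2 \<le> (c * L2_norm_on \<tau> ?w)\<^sup>2"
      by (rule power_mono)
    moreover have "(L2_norm_on \<tau> (gradient ?w))\<^sup>2 = (LINT x:\<tau>|lebesgue. inner (gradient ?w x) (gradient ?w x))"
      unfolding L2_norm_on_def set_lebesgue_integral_def power2_norm_eq_inner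
      by (intro real_sqrt_pow2 Bochner_Integration.integral_nonneg) simp
    moreover have "(L2_norm_on \<tau> ?w)\<^sup>2 = (LINT x:\<tau>|lebesgue. ?w x * ?w x)"
      unfolding L2_norm_on_def set_lebesgue_integral_def power2_norm_eq_inner inner_real_def
      by (intro real_sqrt_pow2 Bochner_Integration.integral_nonneg) simp
    ultimately show ?thesis by (simp add: power_mult_distrib)
  qed
  then show ?thesis
    unfolding stiffness_form[OF v] mass_form[OF v] sum_distrib_left by (rule sum_mono)
qed

text \<open>Here \<open>\<kappa>\<close> is \<open>c\<^sup>2\<close>, whence the fourth power. The
  factor \<open>b\<close> stays free so that it can match the upper constant for the Schur
  complement.\<close>

lemma schur_mat_spectral_bounds:
  assumes inverse_ineq: "\<And>w \<tau>. w \<in> fe_space n \<phi> \<Longrightarrow> \<tau> \<in> \<T> \<Longrightarrow>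
      L2_norm_on \<tau> (gradient w) \<le> c * L2_norm_on \<tau> w"
    and c: "0 \<le> c" and \<rho>: "0 \<le> \<rho>"
  defines "M \<equiv> mass_mat \<Omega> n \<phi>"
    and "D \<equiv> lumped_mass_mat \<Omega> n nbar \<phi>"
    and "S \<equiv> schur_mat \<rho> (stiffness_mat \<Omega> n \<phi>) (lumped_mass_mat \<Omega> n nbar \<phi>) (mass_mat \<Omega> n \<phi>)"
  shows "(1 / (real CARD('d) + 2)) \<cdot>\<^sub>m D \<preceq>\<^sub>m 1 \<cdot>\<^sub>m M"
    and "1 \<cdot>\<^sub>m M \<preceq>\<^sub>m S"
    and "S \<preceq>\<^sub>m (\<rho> * c ^ 4 + 1) \<cdot>\<^sub>m M"
    and "0 \<le> b \<Longrightarrow> b \<cdot>\<^sub>m M \<preceq>\<^sub>m b \<cdot>\<^sub>m D"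
proof -
  let ?K = "stiffness_mat \<Omega> n \<phi>"
  have carrier: "M \<in> carrier_mat n n" "D \<in> carrier_mat n n" "?K \<in> carrier_mat n n"
    by (simp_all add: M_def D_def mass_mat_def lumped_mass_mat_def stiffness_mat_def)
  have sym: "transpose_mat M = M" "transpose_mat D = D" "transpose_mat ?K = ?K"
    by (intro eq_matI; simp add: M_def D_def mass_mat_def lumped_mass_mat_def stiffness_mat_def mult.commute inner_commute)+
  have d: "(LINT x:\<Omega>|lebesgue. \<phi> i x) \<noteq> 0" if "i < n" for i
    using integral_hat_pos[OF that] by simp
  have E: "mat_inv D = mat n n (\<lambda>(i, j). if i = j then 1 / (LINT x:\<Omega>|lebesgue. \<phi> i x) else 0)"
    unfolding D_def lumped_mass_mat_diagonal by (rule mat_inv_diagonal) (rule d)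
  have DE: "D * mat_inv D = 1\<^sub>m n"
    unfolding D_def lumped_mass_mat_diagonal by (rule diagonal_mult_mat_inv) (rule d)
  show "(1 / (real CARD('d) + 2)) \<cdot>\<^sub>m D \<preceq>\<^sub>m 1 \<cdot>\<^sub>m M"
    using mass_lumped_bounds(1) by (intro smult_mat_le[OF carrier(2,1) sym(2,1)]) (simp add: M_def D_def)
  show "b \<cdot>\<^sub>m M \<preceq>\<^sub>m b \<cdot>\<^sub>m D" if "0 \<le> b"
    using mass_lumped_bounds(2) that
    by (intro smult_mat_le[OF carrier(1,2) sym(1,2)] mult_left_mono) (simp_all add: M_def D_def)
  have inv_carrier: "mat_inv D \<in> carrier_mat n n" by (simp add: E)
  have inv_sym: "transpose_mat (mat_inv D) = mat_inv D" unfolding E by (intro eq_matI) auto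
  have c2: "0 \<le> c\<^sup>2" by simp
  note schur = schur_mat_bounds[OF carrier(3) sym(3) carrier(1) sym(1) carrier(2) inv_carrier inv_sym DE
      stiffness_psd stiffness_le_mass[OF inverse_ineq _ c, folded M_def] mass_psd[folded M_def]
      mass_lumped_bounds(2)[folded M_def D_def] c2 \<rho>]
  have "M \<preceq>\<^sub>m S" "S \<preceq>\<^sub>m (\<rho> * (c\<^sup>2)\<^sup>2 + 1) \<cdot>\<^sub>m M"
    unfolding S_def M_def[symmetric] D_def[symmetric] by (rule schur; assumption)+
  moreover have "1 \<cdot>\<^sub>m M = M" by (intro eq_matI) auto
  ultimately show "1 \<cdot>\<^sub>m M \<preceq>\<^sub>m S" "S \<preceq>\<^sub>m (\<rho> * c ^ 4 + 1) \<cdot>\<^sub>m M"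
    by (simp_all flip: power_mult)
qed

end

theorem theorem4:
  fixes \<Omega> :: "(real^'d) set"
    and \<T> :: "'i \<Rightarrow> (real^'d) set set"
    and h :: "'i \<Rightarrow> real"
    and p :: "'i \<Rightarrow> nat \<Rightarrow> real^'d"
    and n nbar :: "'i \<Rightarrow> nat"
    and c_inv :: real
  assumes "CARD('d) \<in> {1, 2, 3}"
    and "bounded_lipschitz_domain \<Omega>"
    and "polyhedrally_bounded \<Omega>"
    and "\<And>i. admissible_mesh \<Omega> (\<T> i)"
    and "shape_regular \<T>"
    and "globally_quasi_uniform \<T> h"
    and "\<And>i. node_numbering \<Omega> (\<T> i) (p i) (n i) (nbar i)"
    and "c_inv > 0"
    and "\<And>i w \<tau>. w \<in> fe_space (n i) (\<lambda>j. hat (\<T> i) (p i j)) \<Longrightarrow> \<tau> \<in> \<T> i \<Longrightarrow>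
           L2_norm_on \<tau> (gradient w) \<le> c_inv * inverse (h i) * L2_norm_on \<tau> w"
  shows
    "let cMD_lower = lambda_min_ref TYPE('d);
         cMD_upper = lambda_max_ref TYPE('d);
         cSM_lower = 1;
         cSM_upper = c_inv ^ 4 * cMD_upper + 1;
         cSD_lower = cMD_lower;
         cSD_upper = cMD_upper\<^sup>2 * c_inv ^ 4 + cMD_upper
     in cMD_lower = 1 / (real CARD('d) + 2) \<and> cMD_upper = 1 \<and>
        (\<forall>i. let \<phi> = (\<lambda>j. hat (\<T> i) (p i j));
                 M = mass_mat \<Omega> (n i) \<phi>;
                 K = stiffness_mat \<Omega> (n i) \<phi>;
                 D = lumped_mass_mat \<Omega> (n i) (nbar i) \<phi>;
                 \<rho> = h i ^ 4;
                 S = schur_mat \<rho> K D M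
             in cSD_lower \<cdot>\<^sub>m D \<preceq>\<^sub>m cSM_lower \<cdot>\<^sub>m M \<and>
                cSM_lower \<cdot>\<^sub>m M \<preceq>\<^sub>m S \<and>
                S \<preceq>\<^sub>m cSM_upper \<cdot>\<^sub>m M \<and>
                cSM_upper \<cdot>\<^sub>m M \<preceq>\<^sub>m cSD_upper \<cdot>\<^sub>m D)"
proof -
  have bounds:
    "(1 / (real CARD('d) + 2)) \<cdot>\<^sub>m D \<preceq>\<^sub>m 1 \<cdot>\<^sub>m M
     \<and> 1 \<cdot>\<^sub>m M \<preceq>\<^sub>m schur_mat (h i ^ 4) K D M
     \<and> schur_mat (h i ^ 4) K D M \<preceq>\<^sub>m (c_inv ^ 4 + 1) \<cdot>\<^sub>m M
     \<and> (c_inv ^ 4 + 1) \<cdot>\<^sub>m M \<preceq>\<^sub>m (c_inv ^ 4 + 1) \<cdot>\<^sub>m D"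
    if "M = mass_mat \<Omega> (n i) (\<lambda>j. hat (\<T> i) (p i j))"
      and "K = stiffness_mat \<Omega> (n i) (\<lambda>j. hat (\<T> i) (p i j))"
      and "D = lumped_mass_mat \<Omega> (n i) (nbar i) (\<lambda>j. hat (\<T> i) (p i j))" for i M K D
  proof -
    \<comment> \<open>Each mesh is treated on its own; uniformity over the family lies in
      \<open>c_inv\<close>, which does not depend on \<open>i\<close>.\<close>
    interpret fe_mesh \<Omega> "\<T> i" "p i" "n i" "nbar i"
      using assms(2,3,4,7) by unfold_locales (auto simp: bounded_lipschitz_domain_def)
    have h: "0 < h i" using assms(6) by (auto simp: globally_quasi_uniform_def)
    have c: "0 \<le> c_inv * inverse (h i)" using h assms(8) by simp
    have "h i ^ 4 * (c_inv * inverse (h i)) ^ 4 = c_inv ^ 4 * (h i * inverse (h i)) ^ 4"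
      by (simp only: power_mult_distrib ac_simps)
    then have scaling: "h i ^ 4 * (c_inv * inverse (h i)) ^ 4 = c_inv ^ 4" using h by simp
    have "0 \<le> h i ^ 4" by simp
    note spectral = schur_mat_spectral_bounds[OF assms(9) c this, unfolded scaling]
    show ?thesis
      unfolding that using spectral(1-3) spectral(4)[of "c_inv ^ 4 + 1"] assms(8) by simp
  qed
  \<comment> \<open>Since the largest reference eigenvalue is 1, both upper constants equal
    \<open>c_inv ^ 4 + 1\<close>, so the last inequality is a scaled comparison of \<open>M\<close>
    with \<open>D\<close>.\<close>
  show ?thesis
    unfolding Let_def lambda_ref_values using bounds by simp
qed

end
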